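(* Let $\lambda\in\mathbb{C}^\times$, $\alpha,\beta,a,b\in\mathbb{C}$ and $\beta_1(\overline{h})\in\mathbb{C}[\overline{h}]$, and let $M_{\alpha,\beta}^{\lambda,a,b}$, $N_{\alpha,\beta}^{\lambda,a,b}$ and $V_{\alpha,\beta}^{\lambda,a,\beta_1(\overline{h})}$ be the $\mathfrak{g}$-modules defined in the context. Then: (i) If $\beta^2+a\neq 0$, then $N_{\alpha,\beta}^{\lambda,a,b}\cong M_{\alpha,\beta}^{\lambda,a,b}$. (ii) If $\beta+a\neq 0$, then $V_{\alpha,\beta}^{\lambda,a,\beta_1(\overline{h})}\cong M_{\alpha,\beta}^{\lambda,-a^2,b}$, where $b=-2a(\lambda\beta_1(a)+1)$.
   Context: All vector spaces and algebras are over $\mathbb{C}$; $\mathbb{C}^\times=\mathbb{C}\setminus\{0\}$, $\mathbb{N}=\{1,2,\dots\}$. $\mathfrak{g}=\mathfrak{sl}_2\otimes_{\mathbb{C}}\mathbb{C}[t]/(t^2)$ is the Takiff Lie algebra for $\mathfrak{sl}_2$, with $[x\otimes t^i,y\otimes t^j]=[x,y]\otimes t^{i+j}$. With the standard basis $e,h,f$ of $\mathfrak{sl}_2$ ($[e,f]=h$, $[h,e]=2e$, $[h,f]=-2f$), identify $x$ with $x\otimes 1$ and put $\overline{x}=x\otimes t$ for $x\in\{e,h,f\}$. Write $\overline{\partial}=\partial/\partial\overline{h}$. The following $\mathfrak{g}$-modules have underlying space $\mathbb{C}[h,\overline{h}]$, with $h,\overline{h}$ acting by multiplication, and for $\gamma=\gamma(h,\overline{h})$: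 $\Gamma(\lambda,a,b)$: $e\cdot\gamma=-2\lambda\,\overline{\partial}(\gamma(h-2,\overline{h}))$, $\overline{e}\cdot\gamma=\lambda\gamma(h-2,\overline{h})$, $\overline{f}\cdot\gamma=-\frac{1}{4\lambda}(\overline{h}^2+a)\gamma(h+2,\overline{h})$, $f\cdot\gamma=-\frac{1}{2\lambda}((h+2)\overline{h}+b)\gamma(h+2,\overline{h})-\frac{1}{2\lambda}(\overline{h}^2+a)\overline{\partial}(\gamma(h+2,\overline{h}))$. $\Theta(\lambda,a,b)$: $f\cdot\gamma=2\lambda\,\overline{\partial}(\gamma(h+2,\overline{h}))$, $\overline{f}\cdot\gamma=\lambda\gamma(h+2,\overline{h})$, $\overline{e}\cdot\gamma=-\frac{1}{4\lambda}(\overline{h}^2+a)\gamma(h-2,\overline{h})$, $e\cdot\gamma=-\frac{1}{2\lambda}((h-2)\overline{h}+b)\gamma(h-2,\overline{h})+\frac{1}{2\lambda}(\overline{h}^2+a)\overline{\partial}(\gamma(h-2,\overline{h}))$. $\Omega(\lambda,a,\beta_1(\overline{h}))$: $e\cdot\gamma=(\frac{\lambda}{2}h+\alpha_1(\overline{h}))\gamma(h-2,\overline{h})-\lambda(\overline{h}+a)\overline{\partial}(\gamma(h-2,\overline{h}))$, $f\cdot\gamma=-(\frac{1}{2\lambda}h-\beta_1(\overline{h}))\gamma(h+2,\overline{h})-\frac{1}{\lambda}(\overline{h}-a)\overline{\partial}(\gamma(h+2,\overline{h}))$, $\overline{e}\cdot\gamma=\frac{\lambda}{2}(\overline{h}+a)\gamma(h-2,\overline{h})$,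 $\overline{f}\cdot\gamma=-\frac{1}{2\lambda}(\overline{h}-a)\gamma(h+2,\overline{h})$, where, writing $\beta_1(\overline{h})=\sum_{i=0}^m q_i\overline{h}^i$, $\alpha_1(\overline{h})=\sum_{i=0}^m p_i\overline{h}^i$ is determined by $p_i=\lambda^2\big(q_i+\sum_{j=i+1}^{m}2a^{\,j-i}q_j\big)$. For a $\mathfrak{g}$-module $M$, the dual space $M^*$ is a $\mathfrak{g}$-module via $(y\cdot\varphi)(v)=-\varphi(y\cdot v)$ for $y\in\mathfrak{g}$. Put $\alpha_k=\alpha+2k$. For $k\in\mathbb{Z}$, $s\in\mathbb{N}$, $\eta_{\alpha_k,\beta^s}:\mathbb{C}[h,\overline{h}]\to\mathbb{C}$ is the linear functional with $\eta_{\alpha_k,\beta^s}\big((h-\alpha_k)^i(\overline{h}-\beta)^j\big)=\delta_{i,0}\delta_{j,s-1}(s-1)!$ for all $i,j\ge0$ (the superscript in $\beta^s$ is only an index). Then $M_{\alpha,\beta}^{\lambda,a,b}$, $N_{\alpha,\beta}^{\lambda,a,b}$, $V_{\alpha,\beta}^{\lambda,a,\beta_1(\overline{h})}$ are the submodules with basis $\{\eta_{\alpha_k,\beta^s}:k\in\mathbb{Z},\,s\in\mathbb{N}\}$ of $\Gamma(\lambda,a,b)^*$, $\Theta(\lambda,a,b)^*$ and $\Omega(\lambda,a,\beta_1(\overline{h}))^*$, respectively. *)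

theory Defs
  imports "HOL-Analysis.Analysis" "HOL-Computational_Algebra.Polynomial"
    "HOL-Library.Function_Algebras"
begin

section \<open>The Takiff Lie algebra of sl(2)\<close>

definition sl2 :: "(complex^2^2) set" where
  "sl2 = {A. trace A = 0}"

definition commutator :: "complex^2^2 \<Rightarrow> complex^2^2 \<Rightarrow> complex^2^2" where
  "commutator A B = A ** B - B ** A"

definition sl2_e :: "complex^2^2" where
  "sl2_e = vector [vector [0, 1], vector [0, 0]]"

definition sl2_h :: "complex^2^2" where
  "sl2_h = vector [vector [1, 0], vector [0, - 1]]"

definition sl2_f :: "complex^2^2" where
  "sl2_f = vector [vector [0, 0], vector [1, 0]]"

text \<open>The pair \<open>(x, y)\<close> stands for the element \<open>x \<otimes> 1 + y \<otimes> t\<close> of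
  \<open>sl2 \<otimes> \<complex>[t]/(t\<^sup>2)\<close>.\<close>

type_synonym takiff_elt = "(complex^2^2) \<times> (complex^2^2)"

definition takiff :: "takiff_elt set" where
  "takiff = sl2 \<times> sl2"

definition pure_tensor :: "complex^2^2 \<Rightarrow> nat \<Rightarrow> takiff_elt" where
  "pure_tensor x i = (if i = 0 then (x, 0) else if i = 1 then (0, x) else (0, 0))"

definition takiff_scale :: "complex \<Rightarrow> takiff_elt \<Rightarrow> takiff_elt" where
  "takiff_scale c x = (\<chi> i j. c * fst x $ i $ j, \<chi> i j. c * snd x $ i $ j)"

definition takiff_bracket :: "takiff_elt \<Rightarrow> takiff_elt \<Rightarrow> takiff_elt" where
  "takiff_bracket x y =
     (commutator (fst x) (fst y), commutator (fst x) (snd y) + commutator (snd x) (fst y))"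

lemma commutator_nth:
  "commutator A B $ i $ j =
     A $ i $ 1 * B $ 1 $ j + A $ i $ 2 * B $ 2 $ j - (B $ i $ 1 * A $ 1 $ j + B $ i $ 2 * A $ 2 $ j)"
  by (simp add: commutator_def matrix_matrix_mult_def sum_2)

lemma sl2_iff: "A \<in> sl2 \<longleftrightarrow> A $ 2 $ 2 = - (A $ 1 $ 1)"
  by (auto simp: sl2_def trace_def sum_2 add_eq_0_iff)

lemma sl2_commutators:
  "commutator sl2_e sl2_f = sl2_h"
  "commutator sl2_h sl2_e = 2 *\<^sub>R sl2_e"
  "commutator sl2_h sl2_f = (-2) *\<^sub>R sl2_f"
  by (simp_all add: vec_eq_iff forall_2 commutator_nth sl2_e_def sl2_f_def sl2_h_def
      scaleR_conv_of_real)

lemma sl2_basis_mem: "sl2_e \<in> sl2" "sl2_h \<in> sl2" "sl2_f \<in> sl2"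
  by (simp_all add: sl2_iff sl2_e_def sl2_f_def sl2_h_def)

lemma takiff_bracket_pure_tensor:
  "takiff_bracket (pure_tensor x i) (pure_tensor y j) = pure_tensor (commutator x y) (i + j)"
  by (auto simp: takiff_bracket_def pure_tensor_def commutator_def)

lemma takiff_bracket_closed: "x \<in> takiff \<Longrightarrow> y \<in> takiff \<Longrightarrow> takiff_bracket x y \<in> takiff"
  by (auto simp: takiff_def takiff_bracket_def sl2_iff commutator_nth algebra_simps)


section \<open>Modules over the Takiff algebra\<close>

record 'v g_module =
  smul :: "complex \<Rightarrow> 'v \<Rightarrow> 'v"
  carr :: "'v set"
  act :: "takiff_elt \<Rightarrow> 'v \<Rightarrow> 'v"

definition is_g_module :: "'v::ab_group_add g_module \<Rightarrow> bool" where
  "is_g_module M \<longleftrightarrow>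
     vector_space (smul M) \<and> module.subspace (smul M) (carr M) \<and>
     (\<forall>x\<in>takiff. \<forall>v\<in>carr M. act M x v \<in> carr M) \<and>
     (\<forall>x\<in>takiff. \<forall>v\<in>carr M. \<forall>w\<in>carr M. act M x (v + w) = act M x v + act M x w) \<and>
     (\<forall>x\<in>takiff. \<forall>v\<in>carr M. \<forall>c. act M x (smul M c v) = smul M c (act M x v)) \<and>
     (\<forall>x\<in>takiff. \<forall>y\<in>takiff. \<forall>v\<in>carr M. act M (x + y) v = act M x v + act M y v) \<and>
     (\<forall>x\<in>takiff. \<forall>v\<in>carr M. \<forall>c. act M (takiff_scale c x) v = smul M c (act M x v)) \<and>
     (\<forall>x\<in>takiff. \<forall>y\<in>takiff. \<forall>v\<in>carr M.
        act M (takiff_bracket x y) v = act M x (act M y v) - act M y (act M x v))"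

definition g_isomorphic :: "'v::ab_group_add g_module \<Rightarrow> 'w::ab_group_add g_module \<Rightarrow> bool"
    (infix "\<cong>\<^sub>g" 50) where
  "M \<cong>\<^sub>g N \<longleftrightarrow> is_g_module M \<and> is_g_module N \<and>
     (\<exists>\<phi>. bij_betw \<phi> (carr M) (carr N) \<and>
        (\<forall>v\<in>carr M. \<forall>w\<in>carr M. \<phi> (v + w) = \<phi> v + \<phi> w) \<and>
        (\<forall>v\<in>carr M. \<forall>c. \<phi> (smul M c v) = smul N c (\<phi> v)) \<and>
        (\<forall>x\<in>takiff. \<forall>v\<in>carr M. \<phi> (act M x v) = act N x (\<phi> v)))"

text \<open>A functional on the carrier is represented by a function on the whole type that vanishes
  off the carrier.\<close>

definition dual_module :: "'v::ab_group_add g_module \<Rightarrow> ('v \<Rightarrow> complex) g_module" where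
  "dual_module M =
     \<lparr> smul = (\<lambda>c \<phi> v. c * \<phi> v),
       carr = {\<phi>. (\<forall>v. v \<notin> carr M \<longrightarrow> \<phi> v = 0) \<and>
                  (\<forall>v\<in>carr M. \<forall>w\<in>carr M. \<phi> (v + w) = \<phi> v + \<phi> w) \<and>
                  (\<forall>v\<in>carr M. \<forall>c. \<phi> (smul M c v) = c * \<phi> v)},
       act = (\<lambda>x \<phi> v. if v \<in> carr M then - \<phi> (act M x v) else 0) \<rparr>"

text \<open>The linear extension to the whole algebra of prescribed operators for
  \<open>e, h, f, e \<otimes> t, h \<otimes> t, f \<otimes> t\<close>; the matrix entries \<open>$1$2\<close>, \<open>$1$1\<close>, \<open>$2$1\<close> are the
  coordinates along \<open>e\<close>, \<open>h\<close>, \<open>f\<close>.\<close>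

definition takiff_action ::
  "(complex \<Rightarrow> 'v::ab_group_add \<Rightarrow> 'v) \<Rightarrow> ('v \<Rightarrow> 'v) \<Rightarrow> ('v \<Rightarrow> 'v) \<Rightarrow> ('v \<Rightarrow> 'v) \<Rightarrow>
   ('v \<Rightarrow> 'v) \<Rightarrow> ('v \<Rightarrow> 'v) \<Rightarrow> ('v \<Rightarrow> 'v) \<Rightarrow> takiff_elt \<Rightarrow> 'v \<Rightarrow> 'v" where
  "takiff_action scl E H F Eb Hb Fb x v =
     scl (fst x $ 1 $ 2) (E v) + scl (fst x $ 1 $ 1) (H v) + scl (fst x $ 2 $ 1) (F v) +
     scl (snd x $ 1 $ 2) (Eb v) + scl (snd x $ 1 $ 1) (Hb v) + scl (snd x $ 2 $ 1) (Fb v)"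

lemma takiff_action_basis:
  assumes "vector_space scl"
  shows "takiff_action scl E H F Eb Hb Fb (pure_tensor sl2_e 0) = E"
    "takiff_action scl E H F Eb Hb Fb (pure_tensor sl2_h 0) = H"
    "takiff_action scl E H F Eb Hb Fb (pure_tensor sl2_f 0) = F"
    "takiff_action scl E H F Eb Hb Fb (pure_tensor sl2_e 1) = Eb"
    "takiff_action scl E H F Eb Hb Fb (pure_tensor sl2_h 1) = Hb"
    "takiff_action scl E H F Eb Hb Fb (pure_tensor sl2_f 1) = Fb"
proof -
  interpret vector_space scl by fact
  show "takiff_action scl E H F Eb Hb Fb (pure_tensor sl2_e 0) = E"
    "takiff_action scl E H F Eb Hb Fb (pure_tensor sl2_h 0) = H"
    "takiff_action scl E H F Eb Hb Fb (pure_tensor sl2_f 0) = F"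
    "takiff_action scl E H F Eb Hb Fb (pure_tensor sl2_e 1) = Eb"
    "takiff_action scl E H F Eb Hb Fb (pure_tensor sl2_h 1) = Hb"
    "takiff_action scl E H F Eb Hb Fb (pure_tensor sl2_f 1) = Fb"
    by (simp_all add: fun_eq_iff takiff_action_def pure_tensor_def sl2_e_def sl2_h_def sl2_f_def)
qed

lemma is_g_module_takiff_action:
  assumes "vector_space scl"
  assumes add: "\<And>X v w. X \<in> {E, H, F, Eb, Hb, Fb} \<Longrightarrow> X (v + w) = X v + X w"
  assumes scale: "\<And>X c v. X \<in> {E, H, F, Eb, Hb, Fb} \<Longrightarrow> X (scl c v) = scl c (X v)"
  assumes rel: "\<And>v. E (F v) = F (E v) + H v"
    "\<And>v. H (E v) = E (H v) + E v + E v"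
    "\<And>v. H (F v) = F (H v) - F v - F v"
    "\<And>v. E (Fb v) = Fb (E v) + Hb v"
    "\<And>v. Eb (F v) = F (Eb v) + Hb v"
    "\<And>v. H (Eb v) = Eb (H v) + Eb v + Eb v"
    "\<And>v. Hb (E v) = E (Hb v) + Eb v + Eb v"
    "\<And>v. H (Fb v) = Fb (H v) - Fb v - Fb v"
    "\<And>v. Hb (F v) = F (Hb v) - Fb v - Fb v"
    "\<And>v. E (Eb v) = Eb (E v)" "\<And>v. H (Hb v) = Hb (H v)" "\<And>v. F (Fb v) = Fb (F v)"
    "\<And>v. Eb (Fb v) = Fb (Eb v)" "\<And>v. Hb (Eb v) = Eb (Hb v)" "\<And>v. Hb (Fb v) = Fb (Hb v)"
  shows "is_g_module \<lparr>smul = scl, carr = UNIV, act = takiff_action scl E H F Eb Hb Fb\<rparr>"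
proof -
  interpret vector_space scl by fact
  note add' = add[of E] add[of H] add[of F] add[of Eb] add[of Hb] add[of Fb]
  note scale' = scale[of E] scale[of H] scale[of F] scale[of Eb] scale[of Hb] scale[of Fb]
  let ?A = "takiff_action scl E H F Eb Hb Fb"
  have A1: "?A x (v + w) = ?A x v + ?A x w" for x v w
    by (simp add: takiff_action_def add' scale_right_distrib add_ac)
  have A2: "?A x (scl c v) = scl c (?A x v)" for x c v
    by (simp add: takiff_action_def scale' scale_right_distrib mult.commute)
  have A3: "?A (x + y) v = ?A x v + ?A y v" for x y v
    by (simp add: takiff_action_def scale_left_distrib add_ac)
  have A4: "?A (takiff_scale c x) v = scl c (?A x v)" for x c v
    by (simp add: takiff_action_def takiff_scale_def scale_right_distrib)
  have A5: "?A (takiff_bracket x y) v = ?A x (?A y v) - ?A y (?A x v)"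
    if xy: "x \<in> takiff" "y \<in> takiff" for x y v
  proof -
    have [simp]: "fst x $ 2 $ 2 = - (fst x $ 1 $ 1)" "snd x $ 2 $ 2 = - (snd x $ 1 $ 1)"
      "fst y $ 2 $ 2 = - (fst y $ 1 $ 1)" "snd y $ 2 $ 2 = - (snd y $ 1 $ 1)"
      using xy by (auto simp: takiff_def sl2_iff)
    have two: "scl (2 * c) v = scl c v + scl c v" for c v
      by (simp add: scale_left_distrib[symmetric])
    show ?thesis
      unfolding takiff_action_def takiff_bracket_def
      by (simp add: commutator_nth add' scale' rel scale_left_distrib scale_right_distrib
          scale_left_diff_distrib scale_right_diff_distrib two algebra_simps)
  qed
  show ?thesis
    unfolding is_g_module_def using \<open>vector_space scl\<close>
    by (simp add: A1 A2 A3 A4 A5 subspace_UNIV)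
qed

lemma is_g_module_sub_dual:
  fixes M :: "'v::ab_group_add g_module"
  assumes M: "is_g_module M" and W: "W \<subseteq> carr (dual_module M)"
    and sub: "module.subspace (smul (dual_module M)) W"
    and cl: "\<And>x \<phi>. x \<in> takiff \<Longrightarrow> \<phi> \<in> W \<Longrightarrow> act (dual_module M) x \<phi> \<in> W"
  shows "is_g_module (dual_module M\<lparr>carr := W\<rparr>)"
proof -
  have vs: "vector_space (smul (dual_module M))"
    by unfold_locales (auto simp: dual_module_def fun_eq_iff algebra_simps)
  have mcl: "act M x v \<in> carr M" if "x \<in> takiff" "v \<in> carr M" for x v
    using M that unfolding is_g_module_def by blast
  have msub: "module.subspace (smul M) (carr M)" "vector_space (smul M)"
    using M unfolding is_g_module_def by blast+
  interpret V: vector_space "smul M" by fact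
  have mscl: "smul M c v \<in> carr M" if "v \<in> carr M" for c v
    using V.subspace_scale[OF msub(1) that] .
  have W1: "\<phi> (v + w) = \<phi> v + \<phi> w" if "\<phi> \<in> W" "v \<in> carr M" "w \<in> carr M" for \<phi> v w
    using W that by (auto simp: dual_module_def)
  have W2: "\<phi> (smul M c v) = c * \<phi> v" if "\<phi> \<in> W" "v \<in> carr M" for \<phi> v c
    using W that by (auto simp: dual_module_def)
  have W3: "\<phi> (v - w) = \<phi> v - \<phi> w" if "\<phi> \<in> W" "v \<in> carr M" "w \<in> carr M" for \<phi> v w
  proof -
    have "\<phi> (v + smul M (-1) w) = \<phi> v + (-1) * \<phi> w"
      using that W1[of \<phi> v "smul M (-1) w"] W2[of \<phi> w "-1"] mscl[of w "-1"] by simp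
    then show ?thesis by simp
  qed
  have A: "act M (x + y) v = act M x v + act M y v"
    "act M (takiff_scale c x) v = smul M c (act M x v)"
    "act M (takiff_bracket x y) v = act M x (act M y v) - act M y (act M x v)"
    if "x \<in> takiff" "y \<in> takiff" "v \<in> carr M" for x y v c
    using M that unfolding is_g_module_def by blast+
  show ?thesis
    unfolding is_g_module_def
  proof (intro conjI ballI allI)
    show "vector_space (smul (dual_module M\<lparr>carr := W\<rparr>))" using vs by simp
    show "module.subspace (smul (dual_module M\<lparr>carr := W\<rparr>)) (carr (dual_module M\<lparr>carr := W\<rparr>))"
      using sub by simp
  next
    fix x \<phi> assume "x \<in> takiff" "\<phi> \<in> carr (dual_module M\<lparr>carr := W\<rparr>)"
    then show "act (dual_module M\<lparr>carr := W\<rparr>) x \<phi> \<in> carr (dual_module M\<lparr>carr := W\<rparr>)"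
      using cl by simp
  qed (auto simp: dual_module_def fun_eq_iff A W1 W2 W3 mcl)
qed

section \<open>The modules on \<open>\<complex>[h, hb]\<close>\<close>

text \<open>The variable \<open>hb\<close> corresponds to \<open>h \<otimes> t\<close>. An element of \<open>\<complex>[h, hb]\<close> is a polynomial in \<open>hb\<close> whose coefficients are polynomials
  in \<open>h\<close>; so \<^const>\<open>pderiv\<close> is the partial derivative with respect to \<open>hb\<close>.\<close>

type_synonym cpoly2 = "complex poly poly"

definition con :: "complex \<Rightarrow> cpoly2" where
  "con c = [:[:c:]:]"

definition var_h :: cpoly2 where
  "var_h = [:[:0, 1:]:]"

definition var_hb :: cpoly2 where
  "var_hb = [:0, 1:]"

text \<open>\<open>in_hb p\<close> is \<open>p(hb)\<close>, and \<open>shift c \<gamma>\<close> is \<open>\<gamma>(h + c, hb)\<close>.\<close>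

definition in_hb :: "complex poly \<Rightarrow> cpoly2" where
  "in_hb p = map_poly (\<lambda>c. [:c:]) p"

definition shift :: "complex \<Rightarrow> cpoly2 \<Rightarrow> cpoly2" where
  "shift c \<gamma> = map_poly (\<lambda>q. pcompose q [:c, 1:]) \<gamma>"

definition cscale :: "complex \<Rightarrow> cpoly2 \<Rightarrow> cpoly2" where
  "cscale c \<gamma> = smult [:c:] \<gamma>"

text \<open>The arguments are the operators of \<open>e, f, e \<otimes> t, f \<otimes> t\<close>.\<close>

definition poly_module ::
  "(cpoly2 \<Rightarrow> cpoly2) \<Rightarrow> (cpoly2 \<Rightarrow> cpoly2) \<Rightarrow> (cpoly2 \<Rightarrow> cpoly2) \<Rightarrow> (cpoly2 \<Rightarrow> cpoly2) \<Rightarrow>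
   cpoly2 g_module" where
  "poly_module E F Eb Fb =
     \<lparr> smul = cscale, carr = UNIV,
       act = takiff_action cscale E (\<lambda>\<gamma>. var_h * \<gamma>) F Eb (\<lambda>\<gamma>. var_hb * \<gamma>) Fb \<rparr>"

definition Gamma_module :: "complex \<Rightarrow> complex \<Rightarrow> complex \<Rightarrow> cpoly2 g_module" where
  "Gamma_module l a b = poly_module
     (\<lambda>\<gamma>. con (- 2 * l) * pderiv (shift (- 2) \<gamma>))
     (\<lambda>\<gamma>. con (- (1 / (2 * l))) * ((var_h + con 2) * var_hb + con b) * shift 2 \<gamma>
          - con (1 / (2 * l)) * (var_hb^2 + con a) * pderiv (shift 2 \<gamma>))
     (\<lambda>\<gamma>. con l * shift (- 2) \<gamma>)
     (\<lambda>\<gamma>. con (- (1 / (4 * l))) * (var_hb^2 + con a) * shift 2 \<gamma>)"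

definition Theta_module :: "complex \<Rightarrow> complex \<Rightarrow> complex \<Rightarrow> cpoly2 g_module" where
  "Theta_module l a b = poly_module
     (\<lambda>\<gamma>. con (- (1 / (2 * l))) * ((var_h - con 2) * var_hb + con b) * shift (- 2) \<gamma>
          + con (1 / (2 * l)) * (var_hb^2 + con a) * pderiv (shift (- 2) \<gamma>))
     (\<lambda>\<gamma>. con (2 * l) * pderiv (shift 2 \<gamma>))
     (\<lambda>\<gamma>. con (- (1 / (4 * l))) * (var_hb^2 + con a) * shift (- 2) \<gamma>)
     (\<lambda>\<gamma>. con l * shift 2 \<gamma>)"

definition alpha1 :: "complex \<Rightarrow> complex \<Rightarrow> complex poly \<Rightarrow> complex poly" where
  "alpha1 l a \<beta>1 =
     (\<Sum>i\<le>degree \<beta>1. monom (l^2 * (coeff \<beta>1 i +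
        (\<Sum>j=i+1..degree \<beta>1. 2 * a^(j - i) * coeff \<beta>1 j))) i)"

definition Omega_module :: "complex \<Rightarrow> complex \<Rightarrow> complex poly \<Rightarrow> cpoly2 g_module" where
  "Omega_module l a \<beta>1 = poly_module
     (\<lambda>\<gamma>. (con (l / 2) * var_h + in_hb (alpha1 l a \<beta>1)) * shift (- 2) \<gamma>
          - con l * (var_hb + con a) * pderiv (shift (- 2) \<gamma>))
     (\<lambda>\<gamma>. - ((con (1 / (2 * l)) * var_h - in_hb \<beta>1) * shift 2 \<gamma>)
          - con (1 / l) * (var_hb - con a) * pderiv (shift 2 \<gamma>))
     (\<lambda>\<gamma>. con (l / 2) * (var_hb + con a) * shift (- 2) \<gamma>)
     (\<lambda>\<gamma>. con (- (1 / (2 * l))) * (var_hb - con a) * shift 2 \<gamma>)"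

text \<open>Existence and uniqueness of this functional are proved below
  (\<open>linear_eta\<close>, \<open>eta_basis\<close>, \<open>linear_functional_unique\<close>).\<close>

definition eta :: "complex \<Rightarrow> complex \<Rightarrow> nat \<Rightarrow> cpoly2 \<Rightarrow> complex" where
  "eta x y s = (THE \<phi>. Vector_Spaces.linear cscale (*) \<phi> \<and>
     (\<forall>i j. \<phi> ((var_h - con x)^i * (var_hb - con y)^j) = (if i = 0 \<and> j = s - 1 then fact (s - 1) else 0)))"

definition eta_span :: "complex \<Rightarrow> complex \<Rightarrow> (cpoly2 \<Rightarrow> complex) set" where
  "eta_span \<alpha> \<beta> =
     module.span (\<lambda>c \<phi> v. c * \<phi> v) {eta (\<alpha> + 2 * of_int k) \<beta> s | (k::int) s. s \<ge> 1}"

text \<open>The three submodules have the same underlying subspace of the dual space.\<close>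

definition M_module ::
  "complex \<Rightarrow> complex \<Rightarrow> complex \<Rightarrow> complex \<Rightarrow> complex \<Rightarrow> (cpoly2 \<Rightarrow> complex) g_module" where
  "M_module \<alpha> \<beta> l a b = dual_module (Gamma_module l a b)\<lparr>carr := eta_span \<alpha> \<beta>\<rparr>"

definition N_module ::
  "complex \<Rightarrow> complex \<Rightarrow> complex \<Rightarrow> complex \<Rightarrow> complex \<Rightarrow> (cpoly2 \<Rightarrow> complex) g_module" where
  "N_module \<alpha> \<beta> l a b = dual_module (Theta_module l a b)\<lparr>carr := eta_span \<alpha> \<beta>\<rparr>"

definition V_module ::
  "complex \<Rightarrow> complex \<Rightarrow> complex \<Rightarrow> complex \<Rightarrow> complex poly \<Rightarrow> (cpoly2 \<Rightarrow> complex) g_module" where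
  "V_module \<alpha> \<beta> l a \<beta>1 = dual_module (Omega_module l a \<beta>1)\<lparr>carr := eta_span \<alpha> \<beta>\<rparr>"

section \<open>Well-definedness of the modules\<close>

lemma coeff_shift: "coeff (shift c p) n = pcompose (coeff p n) [:c, 1:]"
  by (simp add: shift_def coeff_map_poly)

lemma shift_add: "shift c (p + q) = shift c p + shift c q"
  by (simp add: poly_eq_iff[of "shift _ _"] coeff_shift pcompose_add)

lemma shift_minus: "shift c (- p) = - shift c p"
  by (simp add: poly_eq_iff[of "shift _ _"] coeff_shift pcompose_uminus)

lemma shift_diff: "shift c (p - q) = shift c p - shift c q"
  by (simp add: poly_eq_iff[of "shift _ _"] coeff_shift pcompose_diff)

lemma shift_mult: "shift c (p * q) = shift c p * shift c q"
  by (rule poly_eqI) (simp add: coeff_shift coeff_mult pcompose_sum pcompose_mult)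

lemma shift_pCons: "shift c (pCons q p) = pCons (pcompose q [:c, 1:]) (shift c p)"
  by (rule poly_eqI) (simp add: coeff_shift coeff_pCons split: nat.split)

lemma shift_0: "shift c 0 = 0"
  by (simp add: shift_def)

lemma shift_1: "shift c 1 = 1"
  by (rule poly_eqI) (simp add: coeff_shift pcompose_1)

lemma shift_con: "shift c (con d) = con d"
  by (simp add: con_def shift_pCons shift_0 pcompose_pCons)

lemma shift_hb: "shift c var_hb = var_hb"
  by (simp add: var_hb_def shift_pCons shift_0 pcompose_1)

lemma shift_h: "shift c var_h = var_h + con c"
  by (simp add: var_h_def con_def shift_pCons shift_0 pcompose_pCons)

lemma shift_power: "shift c (p ^ n) = shift c p ^ n"
  by (induction n) (simp_all add: shift_mult shift_1)

lemma coeff_in_hb: "coeff (in_hb p) n = [:coeff p n:]"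
  by (simp add: in_hb_def coeff_map_poly)

lemma shift_in_hb: "shift c (in_hb p) = in_hb p"
  by (rule poly_eqI) (simp add: coeff_shift coeff_in_hb pcompose_pCons)

lemma shift_of_nat: "shift c (of_nat n) = of_nat n"
  by (induction n) (simp_all add: shift_0 shift_1 shift_add)

lemma shift_pderiv: "shift c (pderiv p) = pderiv (shift c p)"
proof (rule poly_eqI)
  fix n
  have "pcompose (of_nat m) q = of_nat m" for m and q :: "complex poly"
    by (induction m) (simp_all add: pcompose_1 pcompose_add)
  show "coeff (shift c (pderiv p)) n = coeff (pderiv (shift c p)) n"
    unfolding coeff_shift coeff_pderiv pcompose_mult by (simp only: \<open>\<And>m q. pcompose (of_nat m) q = of_nat m\<close>)
qed

lemma shift_shift: "shift c (shift d p) = shift (c + d) p"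
  by (rule poly_eqI) (simp add: coeff_shift pcompose_assoc[symmetric] pcompose_pCons add.commute)

lemma shift_zero: "shift 0 p = p"
  by (rule poly_eqI) (simp add: coeff_shift pcompose_idR)

lemma pderiv_con: "pderiv (con c) = 0"
  and pderiv_h: "pderiv var_h = 0"
  and pderiv_hb: "pderiv var_hb = 1"
  by (simp_all add: con_def var_h_def var_hb_def pderiv_pCons)

lemma con_algebra:
  "con (c + d) = con c + con d" "con (- c) = - con c" "con (c - d) = con c - con d"
  "con (c * d) = con c * con d" "con 0 = 0" "con 1 = 1" "con (numeral k) = numeral k"
  by (simp_all add: con_def one_pCons numeral_poly)

lemma cscale_conv: "cscale c p = con c * p"
  by (simp add: cscale_def con_def)

lemma in_hb_algebra:
  "in_hb (p + q) = in_hb p + in_hb q" "in_hb (p - q) = in_hb p - in_hb q"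
  "in_hb (p * q) = in_hb p * in_hb q" "in_hb [:c:] = con c" "in_hb [:c, 1:] = var_hb + con c"
  "in_hb (smult c p) = con c * in_hb p"
proof -
  have pCons_0: "in_hb (pCons c p) = pCons [:c:] (in_hb p)" for c p
    by (rule poly_eqI) (simp add: coeff_in_hb coeff_pCons split: nat.split)
  have z: "in_hb 0 = 0" by (simp add: in_hb_def)
  have sum: "[:sum g A:] = (\<Sum>i\<in>A. [:g i:])" for g :: "nat \<Rightarrow> complex" and A
  proof (induction A rule: infinite_finite_induct)
    case (insert x F)
    have "[:g x + sum g F:] = [:g x:] + [:sum g F:]" by simp
    then show ?case using insert by simp
  qed simp_all
  show "in_hb (p + q) = in_hb p + in_hb q" "in_hb (p - q) = in_hb p - in_hb q"
    "in_hb (p * q) = in_hb p * in_hb q" "in_hb [:c:] = con c" "in_hb [:c, 1:] = var_hb + con c"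
    "in_hb (smult c p) = con c * in_hb p"
    subgoal by (rule poly_eqI) (simp add: coeff_in_hb)
    subgoal by (rule poly_eqI) (simp add: coeff_in_hb)
    subgoal by (rule poly_eqI) (simp add: coeff_in_hb coeff_mult sum mult.commute[of "coeff p _"])
    subgoal by (simp add: pCons_0 z con_def)
    subgoal by (simp add: pCons_0 z con_def var_hb_def one_pCons)
    subgoal by (rule poly_eqI) (simp add: coeff_in_hb con_def)
    done
qed

lemma vector_space_cscale: "vector_space cscale"
  by unfold_locales (simp_all add: cscale_conv con_algebra algebra_simps)

lemmas op_simps = shift_add shift_minus shift_diff shift_mult shift_con shift_hb shift_h shift_power
    shift_in_hb shift_pderiv shift_shift shift_zero pderiv_con pderiv_h pderiv_hb
    pderiv_add pderiv_minus pderiv_diff pderiv_mult cscale_conv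

lemma shift_numeral: "shift c (numeral k) = numeral k"
  by (metis shift_of_nat of_nat_numeral)

lemma pderiv_numeral: "pderiv (numeral k :: cpoly2) = 0"
  by (metis con_algebra(7) pderiv_con)

lemma con_fractions:
  assumes "l \<noteq> 0"
  obtains L W H where "con (1 / (2 * l)) = H * W" "con (1 / (4 * l)) = H * H * W"
    "con (l / 2) = H * L" "con (1 / l) = W" "con l = L" "L * W = 1" "2 * H = 1"
    "\<And>x. shift x L = L" "\<And>x. shift x W = W" "\<And>x. shift x H = H"
    "pderiv L = 0" "pderiv W = 0" "pderiv H = 0"
proof (rule that[of "con (1 / 2)" "con (1 / l)" "con l"])
  have "1 / (2 * l) = 1/2 * (1/l)" "1 / (4 * l) = 1/2 * (1/2) * (1/l)" "l / 2 = 1/2 * l"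
    by simp_all
  then show "con (1 / (2 * l)) = con (1 / 2) * con (1 / l)"
    "con (1 / (4 * l)) = con (1 / 2) * con (1 / 2) * con (1 / l)"
    "con (l / 2) = con (1 / 2) * con l"
    by (simp_all only: con_algebra)
  have "con l * con (1 / l) = con (l * (1 / l))" "2 * con (1 / 2) = con (2 * (1/2))"
    by (simp_all only: con_algebra)
  then show "con l * con (1 / l) = 1" "2 * con (1 / 2) = 1"
    using assms(1) by (simp_all add: con_algebra)
qed (simp_all add: shift_con pderiv_con)


lemma is_g_module_Gamma:
  assumes "l \<noteq> 0"
  shows "is_g_module (Gamma_module l a b)"
proof -
  obtain L W H where c: "con (1 / (2 * l)) = H * W" "con (1 / (4 * l)) = H * H * W"
    "con (l / 2) = H * L" "con (1 / l) = W" "con l = L" and d: "L * W = 1" "2 * H = 1"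
    and s: "\<And>x. shift x L = L" "\<And>x. shift x W = W" "\<And>x. shift x H = H"
    "pderiv L = 0" "pderiv W = 0" "pderiv H = 0"
    using con_fractions[OF assms] by metis
  show ?thesis
    unfolding Gamma_module_def poly_module_def
    apply (rule is_g_module_takiff_action[OF vector_space_cscale])
    apply (auto simp: op_simps algebra_simps)[2]
    apply (simp_all add: op_simps con_algebra c power2_eq_square s shift_numeral pderiv_numeral shift_1
        del: mult_eq_0_iff mult_cancel_left mult_cancel_right)
    apply (insert d)
    apply ((simp add: algebra_simps; fail) | algebra)+
    done
qed

lemma is_g_module_Theta:
  assumes "l \<noteq> 0"
  shows "is_g_module (Theta_module l a b)"
proof -
  obtain L W H where c: "con (1 / (2 * l)) = H * W" "con (1 / (4 * l)) = H * H * W"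
    "con (l / 2) = H * L" "con (1 / l) = W" "con l = L" and d: "L * W = 1" "2 * H = 1"
    and s: "\<And>x. shift x L = L" "\<And>x. shift x W = W" "\<And>x. shift x H = H"
    "pderiv L = 0" "pderiv W = 0" "pderiv H = 0"
    using con_fractions[OF assms] by metis
  show ?thesis
    unfolding Theta_module_def poly_module_def
    apply (rule is_g_module_takiff_action[OF vector_space_cscale])
    apply (auto simp: op_simps algebra_simps)[2]
    apply (simp_all add: op_simps con_algebra c power2_eq_square s shift_numeral pderiv_numeral shift_1
        del: mult_eq_0_iff mult_cancel_left mult_cancel_right)
    apply (insert d)
    apply ((simp add: algebra_simps; fail) | algebra)+
    done
qed

lemma alpha1_eq:
  "[:- a, 1:] * alpha1 l a p = smult (l^2) ([:a, 1:] * p - [:2 * a * poly p a:])"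
proof -
  define m where "m = degree p"
  define R where "R i = (\<Sum>j=i+1..m. a^(j - i) * coeff p j)" for i
  have cf: "coeff (alpha1 l a p) i = l^2 * (coeff p i + 2 * R i)" for i
  proof (cases "i \<le> m")
    case True
    then show ?thesis
      by (simp add: alpha1_def coeff_sum m_def[symmetric] R_def sum_distrib_left mult.assoc)
  next
    case False
    then have "coeff p i = 0" "R i = 0"
      by (simp_all add: m_def R_def coeff_eq_0)
    then show ?thesis using False
      by (simp add: alpha1_def coeff_sum m_def[symmetric])
  qed
  have R: "R i = a * coeff p (Suc i) + a * R (Suc i)" for i
  proof (cases "i < m")
    case True
    then have "R i = a * coeff p (Suc i) + (\<Sum>j=Suc (Suc i)..m. a^(j - i) * coeff p j)"
      unfolding R_def by (subst sum.atLeast_Suc_atMost) simp_all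
    also have "(\<Sum>j=Suc (Suc i)..m. a^(j - i) * coeff p j) = a * R (Suc i)"
      unfolding R_def sum_distrib_left
      by (intro sum.cong refl) (auto simp: Suc_diff_Suc[symmetric] Suc_le_eq)
    finally show ?thesis .
  next
    case False
    then show ?thesis by (simp add: R_def m_def coeff_eq_0)
  qed
  have P: "poly p a = coeff p 0 + R 0"
    unfolding poly_altdef R_def m_def[symmetric] atMost_atLeast0
    by (subst sum.atLeast_Suc_atMost) (simp_all add: mult.commute)
  show ?thesis
  proof (rule poly_eqI)
    fix n
    show "coeff ([:- a, 1:] * alpha1 l a p) n =
      coeff (smult (l^2) ([:a, 1:] * p - [:2 * a * poly p a:])) n"
    proof (cases n)
      case 0
      then show ?thesis by (simp add: cf P algebra_simps)
    next
      case (Suc k)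
      then show ?thesis using R[of k] by (simp add: cf algebra_simps)
    qed
  qed
qed

lemma is_g_module_Omega:
  assumes "l \<noteq> 0"
  shows "is_g_module (Omega_module l a \<beta>1)"
proof -
  obtain L W H where c: "con (1 / (2 * l)) = H * W" "con (1 / (4 * l)) = H * H * W"
    "con (l / 2) = H * L" "con (1 / l) = W" "con l = L" and d: "L * W = 1" "2 * H = 1"
    and s: "\<And>x. shift x L = L" "\<And>x. shift x W = W" "\<And>x. shift x H = H"
    "pderiv L = 0" "pderiv W = 0" "pderiv H = 0"
    using con_fractions[OF assms] by metis
  define A B where "A = in_hb (alpha1 l a \<beta>1)" and "B = in_hb \<beta>1"
  have sA: "shift x A = A" "shift x B = B" for x
    by (simp_all add: A_def B_def shift_in_hb)
  have "in_hb ([:- a, 1:] * alpha1 l a \<beta>1) =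
      in_hb (smult (l^2) ([:a, 1:] * \<beta>1 - [:2 * a * poly \<beta>1 a:]))"
    by (simp only: alpha1_eq)
  then have K1: "(var_hb - con a) * A = L * L * ((var_hb + con a) * B - con (2 * a * poly \<beta>1 a))"
    unfolding in_hb_algebra A_def[symmetric] B_def[symmetric] power2_eq_square
    unfolding con_algebra c by simp
  then have "pderiv ((var_hb - con a) * A) =
      pderiv (L * L * ((var_hb + con a) * B - con (2 * a * poly \<beta>1 a)))"
    by simp
  then have K2: "A + (var_hb - con a) * pderiv A = L * L * (B + (var_hb + con a) * pderiv B)"
    by (simp add: op_simps s algebra_simps)
  show ?thesis
    unfolding Omega_module_def poly_module_def A_def[symmetric] B_def[symmetric]
    apply (rule is_g_module_takiff_action[OF vector_space_cscale])
    apply (auto simp: op_simps algebra_simps)[2]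
    apply (simp_all add: op_simps con_algebra c power2_eq_square s sA shift_numeral
        pderiv_numeral shift_1
        del: mult_eq_0_iff mult_cancel_left mult_cancel_right)
    subgoal using d K2 by algebra
    apply (insert d)
    apply ((simp add: algebra_simps; fail) | algebra)+
    done
qed

lemma dual_closed:
  assumes sub: "module.subspace (\<lambda>c (\<phi>::cpoly2 \<Rightarrow> complex) v. c * \<phi> v) W"
    and W: "W \<subseteq> Collect (Vector_Spaces.linear cscale (*))"
    and cl: "\<And>X \<phi>. X \<in> {E, \<lambda>v. var_h * v, F, Eb, \<lambda>v. var_hb * v, Fb} \<Longrightarrow> \<phi> \<in> W \<Longrightarrow> (\<lambda>v. \<phi> (X v)) \<in> W"
    and \<phi>: "\<phi> \<in> W"
  shows "act (dual_module (poly_module E F Eb Fb)) x \<phi> \<in> W"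
proof -
  interpret D: vector_space "\<lambda>c (\<phi>::cpoly2 \<Rightarrow> complex) v. c * \<phi> v"
    by unfold_locales (auto simp: fun_eq_iff algebra_simps)
  interpret V: Vector_Spaces.linear cscale "(*)" \<phi> using W \<phi> by blast
  have eq: "act (dual_module (poly_module E F Eb Fb)) x \<phi> =
    (\<lambda>v. - (fst x $ 1 $ 2) * \<phi> (E v)) + (\<lambda>v. - (fst x $ 1 $ 1) * \<phi> (var_h * v)) +
    (\<lambda>v. - (fst x $ 2 $ 1) * \<phi> (F v)) + (\<lambda>v. - (snd x $ 1 $ 2) * \<phi> (Eb v)) +
    (\<lambda>v. - (snd x $ 1 $ 1) * \<phi> (var_hb * v)) + (\<lambda>v. - (snd x $ 2 $ 1) * \<phi> (Fb v))"
    by (simp add: dual_module_def poly_module_def takiff_action_def fun_eq_iff V.add V.scale)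
  show ?thesis
    unfolding eq
    by (intro D.subspace_add[OF sub] D.subspace_scale[OF sub] cl[OF _ \<phi>, of E]
        cl[OF _ \<phi>, of F] cl[OF _ \<phi>, of Eb] cl[OF _ \<phi>, of Fb]
        cl[OF _ \<phi>, of "\<lambda>v. var_h * v"] cl[OF _ \<phi>, of "\<lambda>v. var_hb * v"]) auto
qed

text \<open>The functional \<open>\<gamma> \<mapsto> (\<partial>/\<partial>hb)\<^sup>n \<gamma> (x, y)\<close>.\<close>

definition deriv_at :: "complex \<Rightarrow> complex \<Rightarrow> nat \<Rightarrow> cpoly2 \<Rightarrow> complex" where
  "deriv_at x y n \<gamma> = poly (poly ((pderiv ^^ n) \<gamma>) [:y:]) x"

lemma higher_pderiv_add: "(pderiv ^^ n) (p + q) = (pderiv ^^ n) p + (pderiv ^^ n) (q :: cpoly2)"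
  by (induction n arbitrary: p q) (simp_all add: pderiv_add funpow_Suc_right del: funpow.simps)

lemma higher_pderiv_const:
  "pderiv c = 0 \<Longrightarrow> (pderiv ^^ n) (c * p) = c * (pderiv ^^ n) (p :: cpoly2)"
  by (induction n arbitrary: p) (simp_all add: pderiv_mult funpow_Suc_right del: funpow.simps)

lemma vector_space_functionals: "vector_space (\<lambda>c (\<phi>::cpoly2 \<Rightarrow> complex) v. c * \<phi> v)"
  by unfold_locales (auto simp: fun_eq_iff algebra_simps)

lemma linear_functional_iff:
  "Vector_Spaces.linear cscale (*) (\<phi> :: cpoly2 \<Rightarrow> complex) \<longleftrightarrow>
     (\<forall>p q. \<phi> (p + q) = \<phi> p + \<phi> q) \<and> (\<forall>c p. \<phi> (con c * p) = c * \<phi> p)"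
proof -
  have "vector_space ((*) :: complex \<Rightarrow> complex \<Rightarrow> complex)"
    by unfold_locales (simp_all add: algebra_simps)
  then show ?thesis
    by (simp add: Vector_Spaces.linear_iff vector_space_cscale cscale_conv)
qed

lemma deriv_at_add: "deriv_at x y n (p + q) = deriv_at x y n p + deriv_at x y n q"
  by (simp add: deriv_at_def higher_pderiv_add)

lemma deriv_at_con: "deriv_at x y n (con c * p) = c * deriv_at x y n p"
  by (simp add: deriv_at_def higher_pderiv_const pderiv_con) (simp add: con_def)

lemma deriv_at_diff: "deriv_at x y n (p - q) = deriv_at x y n p - deriv_at x y n q"
  using deriv_at_add[of x y n p "con (-1) * q"] deriv_at_con[of x y n "-1" q]
  by (simp add: con_algebra)

lemma linear_deriv_at: "Vector_Spaces.linear cscale (*) (deriv_at x y n)"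
  by (simp add: linear_functional_iff deriv_at_add deriv_at_con)

lemma deriv_at_h: "deriv_at x y n (var_h * p) = x * deriv_at x y n p"
  by (simp add: deriv_at_def higher_pderiv_const pderiv_h) (simp add: var_h_def)

lemma higher_pderiv_hb:
  "(pderiv ^^ n) (var_hb * p) = var_hb * (pderiv ^^ n) p + of_nat n * (pderiv ^^ (n - 1)) p"
proof (induction n)
  case (Suc n)
  have [simp]: "pderiv (of_nat n :: cpoly2) = 0"
    by (simp add: of_nat_poly)
  have "(pderiv ^^ Suc n) (var_hb * p) = pderiv (var_hb * (pderiv ^^ n) p + of_nat n * (pderiv ^^ (n - 1)) p)"
    by (simp add: Suc)
  also have "\<dots> = var_hb * (pderiv ^^ Suc n) p + (pderiv ^^ n) p + of_nat n * pderiv ((pderiv ^^ (n - 1)) p)"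
    by (simp add: pderiv_add pderiv_mult pderiv_hb)
  also have "of_nat n * pderiv ((pderiv ^^ (n - 1)) p) = of_nat n * (pderiv ^^ n) p"
    by (cases n) simp_all
  finally show ?case by (simp add: algebra_simps)
qed simp

lemma deriv_at_hb: "deriv_at x y n (var_hb * p) = y * deriv_at x y n p + of_nat n * deriv_at x y (n - 1) p"
proof -
  have "poly (poly (of_nat n) [:y:]) x = of_nat n"
    by (simp add: of_nat_poly)
  then show ?thesis by (simp add: deriv_at_def higher_pderiv_hb) (simp add: var_hb_def)
qed

lemma deriv_at_pderiv: "deriv_at x y n (pderiv p) = deriv_at x y (Suc n) p"
  by (simp add: deriv_at_def funpow_Suc_right del: funpow.simps)

lemma poly_shift: "poly (poly (shift c p) [:y:]) x = poly (poly p [:y:]) (x + c)"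
  by (induction p) (simp_all add: shift_0 shift_pCons poly_pcompose add.commute)

lemma deriv_at_shift: "deriv_at x y n (shift c p) = deriv_at (x + c) y n p"
proof -
  have "(pderiv ^^ n) (shift c p) = shift c ((pderiv ^^ n) p)"
    by (induction n) (simp_all add: shift_pderiv)
  then show ?thesis by (simp add: deriv_at_def poly_shift)
qed

lemma deriv_at_basis:
  "deriv_at x y n ((var_h - con x)^i * (var_hb - con y)^j) = (if i = 0 \<and> j = n then fact n else 0)"
proof (cases i)
  case (Suc i')
  have "deriv_at x y n ((var_h - con x) * p) = 0" for p
    by (simp add: left_diff_distrib deriv_at_diff deriv_at_h deriv_at_con)
  then show ?thesis using Suc by (simp add: mult.assoc)
next
  case 0
  have step: "deriv_at x y n ((var_hb - con y) * p) = of_nat n * deriv_at x y (n - 1) p" for n p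
    by (simp add: left_diff_distrib deriv_at_diff deriv_at_hb deriv_at_con)
  have one: "deriv_at x y n 1 = (if n = 0 then 1 else 0)" for n
    by (cases n) (simp_all add: deriv_at_def funpow_Suc_right higher_pderiv_0 del: funpow.simps(2))
  have "deriv_at x y n ((var_hb - con y)^j) = (if j = n then fact n else 0)"
  proof (induction j arbitrary: n)
    case (Suc j)
    show ?case by (cases n) (simp_all add: step Suc)
  qed (simp add: one)
  then show ?thesis using 0 by simp
qed

lemma linear_functional_unique:
  assumes "Vector_Spaces.linear cscale (*) \<phi>" "Vector_Spaces.linear cscale (*) \<psi>"
    and eq: "\<And>i j. \<phi> ((var_h - con x)^i * (var_hb - con y)^j) = \<psi> ((var_h - con x)^i * (var_hb - con y)^j)"
  shows "\<phi> = (\<psi> :: cpoly2 \<Rightarrow> complex)"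
proof -
  have add: "\<phi> (p + q) = \<phi> p + \<phi> q" "\<psi> (p + q) = \<psi> p + \<psi> q"
    and con: "\<phi> (con c * p) = c * \<phi> p" "\<psi> (con c * p) = c * \<psi> p" for p q c
    using assms(1,2) unfolding linear_functional_iff by blast+
  define m where "m i j = (var_h - con x)^i * (var_hb - con y)^j" for i j
  define K where "K = {p. \<forall>i j. \<phi> (m i j * p) = \<psi> (m i j * p)}"
  have K1: "1 \<in> K" using eq by (simp add: K_def m_def)
  have Kadd: "p + q \<in> K" if "p \<in> K" "q \<in> K" for p q
    using that by (simp add: K_def distrib_left add)
  have Kcon: "con c * p \<in> K" if "p \<in> K" for p c
    using that by (simp add: K_def mult.left_commute con)
  have m: "m i j * ((var_h - con x) * p) = m (Suc i) j * p"
    "m i j * ((var_hb - con y) * p) = m i (Suc j) * p" for i j p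
    by (simp_all add: m_def algebra_simps)
  have Kh: "var_h * p \<in> K" if "p \<in> K" for p
  proof -
    have "(var_h - con x) * p \<in> K" using that by (simp add: K_def m)
    from Kadd[OF this Kcon[OF that, of x]] show ?thesis by (simp add: algebra_simps)
  qed
  have Khb: "var_hb * p \<in> K" if "p \<in> K" for p
  proof -
    have "(var_hb - con y) * p \<in> K" using that by (simp add: K_def m)
    from Kadd[OF this Kcon[OF that, of y]] show ?thesis by (simp add: algebra_simps)
  qed
  have K0: "[:q:] \<in> K" for q
  proof (induction q)
    case 0
    show ?case using Kcon[OF K1, of 0] by (simp add: con_def)
  next
    case (pCons c q)
    have "[:pCons c q:] = con c * 1 + var_h * [:q:]" by (simp add: con_def var_h_def)
    then show ?case using Kadd[OF Kcon[OF K1] Kh[OF pCons.IH]] by (simp only:)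
  qed
  have "p \<in> K" for p
  proof (induction p)
    case 0
    show ?case using K0[of 0] by simp
  next
    case (pCons q p)
    have "pCons q p = [:q:] + var_hb * p" by (simp add: var_hb_def)
    then show ?case using Kadd[OF K0 Khb[OF pCons.IH]] by (simp only:)
  qed
  then have "\<phi> (m 0 0 * p) = \<psi> (m 0 0 * p)" for p unfolding K_def by blast
  then show ?thesis by (simp add: m_def fun_eq_iff)
qed

lemma eta_eq: "eta x y s = deriv_at x y (s - 1)"
  unfolding eta_def
proof (rule the_equality)
  fix \<phi> :: "cpoly2 \<Rightarrow> complex"
  assume "Vector_Spaces.linear cscale (*) \<phi> \<and> (\<forall>i j. \<phi> ((var_h - con x)^i * (var_hb - con y)^j) =
    (if i = 0 \<and> j = s - 1 then fact (s - 1) else 0))"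
  then show "\<phi> = deriv_at x y (s - 1)"
    by (intro linear_functional_unique[of _ _ x y]) (simp_all add: linear_deriv_at deriv_at_basis)
qed (simp add: linear_deriv_at deriv_at_basis)

lemma linear_eta: "Vector_Spaces.linear cscale (*) (eta x y s)"
  by (simp add: eta_eq linear_deriv_at)

lemma eta_basis:
  "eta x y s ((var_h - con x)^i * (var_hb - con y)^j) = (if i = 0 \<and> j = s - 1 then fact (s - 1) else 0)"
  by (simp add: eta_eq deriv_at_basis)

lemma subspace_eta_span: "module.subspace (\<lambda>c \<phi> v. c * \<phi> v) (eta_span \<alpha> \<beta>)"
proof -
  interpret D: vector_space "\<lambda>c (\<phi>::cpoly2 \<Rightarrow> complex) v. c * \<phi> v"
    by (rule vector_space_functionals)
  show ?thesis unfolding eta_span_def by (rule D.subspace_span)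
qed

lemma eta_span_linear: "eta_span \<alpha> \<beta> \<subseteq> Collect (Vector_Spaces.linear cscale (*))"
proof -
  interpret D: vector_space "\<lambda>c (\<phi>::cpoly2 \<Rightarrow> complex) v. c * \<phi> v"
    by (rule vector_space_functionals)
  show ?thesis unfolding eta_span_def
  proof (rule D.span_minimal)
    show "D.subspace (Collect (Vector_Spaces.linear cscale (*)))"
      by (rule D.subspaceI) (auto simp: linear_functional_iff algebra_simps)
  qed (auto simp: linear_eta)
qed

lemma deriv_at_mem: "deriv_at (\<alpha> + 2 * of_int k) \<beta> n \<in> eta_span \<alpha> \<beta>"
proof -
  interpret D: vector_space "\<lambda>c (\<phi>::cpoly2 \<Rightarrow> complex) v. c * \<phi> v"
    by (rule vector_space_functionals)
  have "deriv_at (\<alpha> + 2 * of_int k) \<beta> n = eta (\<alpha> + 2 * of_int k) \<beta> (Suc n)"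
    by (simp add: eta_eq)
  then show ?thesis unfolding eta_span_def by (intro D.span_base) fastforce
qed

definition stable_op :: "complex \<Rightarrow> complex \<Rightarrow> (cpoly2 \<Rightarrow> cpoly2) \<Rightarrow> bool" where
  "stable_op \<alpha> \<beta> X \<longleftrightarrow> (\<forall>\<phi>\<in>eta_span \<alpha> \<beta>. (\<lambda>v. \<phi> (X v)) \<in> eta_span \<alpha> \<beta>)"

context
  fixes \<alpha> \<beta> :: complex
begin

interpretation D: vector_space "\<lambda>c (\<phi>::cpoly2 \<Rightarrow> complex) v. c * \<phi> v"
  by (rule vector_space_functionals)

lemma eta_span_add: "\<phi> \<in> eta_span \<alpha> \<beta> \<Longrightarrow> \<psi> \<in> eta_span \<alpha> \<beta> \<Longrightarrow> (\<lambda>v. \<phi> v + \<psi> v) \<in> eta_span \<alpha> \<beta>"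
  using D.subspace_add[OF subspace_eta_span] by (simp add: plus_fun_def)

lemma eta_span_scale: "\<phi> \<in> eta_span \<alpha> \<beta> \<Longrightarrow> (\<lambda>v. c * \<phi> v) \<in> eta_span \<alpha> \<beta>"
  using D.subspace_scale[OF subspace_eta_span] .

lemma eta_span_zero: "(\<lambda>v. 0) \<in> eta_span \<alpha> \<beta>"
  using D.subspace_0[OF subspace_eta_span] by (simp add: zero_fun_def)

lemma eta_span_props:
  assumes "\<phi> \<in> eta_span \<alpha> \<beta>"
  shows "\<phi> (p + q) = \<phi> p + \<phi> q" "\<phi> (con c * p) = c * \<phi> p"
  using eta_span_linear assms linear_functional_iff by blast+

lemma stable_opI:
  assumes "\<And>k n. (\<lambda>v. deriv_at (\<alpha> + 2 * of_int k) \<beta> n (X v)) \<in> eta_span \<alpha> \<beta>"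
  shows "stable_op \<alpha> \<beta> X"
  unfolding stable_op_def
proof
  fix \<phi> assume "\<phi> \<in> eta_span \<alpha> \<beta>"
  then have "\<phi> \<in> D.span {eta (\<alpha> + 2 * of_int k) \<beta> s | (k::int) s. s \<ge> 1}"
    by (simp add: eta_span_def)
  then show "(\<lambda>v. \<phi> (X v)) \<in> eta_span \<alpha> \<beta>"
  proof (induction rule: D.span_induct_alt)
    case base
    then show ?case by (simp add: eta_span_zero)
  next
    case (step c x y)
    then have "(\<lambda>v. x (X v)) \<in> eta_span \<alpha> \<beta>" using assms by (auto simp: eta_eq)
    from eta_span_add[OF eta_span_scale[OF this, of c] step(2)] show ?case by simp
  qed
qed

lemma stable_op_comp: "stable_op \<alpha> \<beta> X \<Longrightarrow> stable_op \<alpha> \<beta> Y \<Longrightarrow> stable_op \<alpha> \<beta> (\<lambda>v. X (Y v))"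
  unfolding stable_op_def by auto

lemma stable_op_add: "stable_op \<alpha> \<beta> X \<Longrightarrow> stable_op \<alpha> \<beta> Y \<Longrightarrow> stable_op \<alpha> \<beta> (\<lambda>v. X v + Y v)"
  unfolding stable_op_def by (simp add: eta_span_props eta_span_add)

lemma stable_op_con: "stable_op \<alpha> \<beta> (\<lambda>v. con c * v)"
  unfolding stable_op_def by (simp add: eta_span_props eta_span_scale)

lemma stable_op_h: "stable_op \<alpha> \<beta> (\<lambda>v. var_h * v)"
  by (rule stable_opI) (simp add: deriv_at_h eta_span_scale deriv_at_mem)

lemma stable_op_hb: "stable_op \<alpha> \<beta> (\<lambda>v. var_hb * v)"
  by (rule stable_opI) (simp add: deriv_at_hb eta_span_add eta_span_scale deriv_at_mem)

lemma stable_op_pderiv: "stable_op \<alpha> \<beta> pderiv"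
  by (rule stable_opI) (simp add: deriv_at_pderiv deriv_at_mem)

lemma stable_op_shift: "stable_op \<alpha> \<beta> (shift 2)" "stable_op \<alpha> \<beta> (shift (- 2))"
proof -
  have *: "(\<alpha> + 2 * of_int k) + 2 = \<alpha> + 2 * of_int (k + 1)"
    "(\<alpha> + 2 * of_int k) + - 2 = \<alpha> + 2 * of_int (k - 1)" for k
    by (simp_all add: algebra_simps)
  show "stable_op \<alpha> \<beta> (shift 2)" "stable_op \<alpha> \<beta> (shift (- 2))"
    by (rule stable_opI, simp only: deriv_at_shift * deriv_at_mem)+
qed

lemma stable_op_mult: "stable_op \<alpha> \<beta> (\<lambda>v. p * v)"
proof (induction p)
  case 0
  show ?case using stable_op_con[of 0] by (simp add: con_algebra)
next
  case (pCons q p)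
  have q: "stable_op \<alpha> \<beta> (\<lambda>v. [:q:] * v)"
  proof (induction q)
    case 0
    show ?case using stable_op_con[of 0] by (simp add: con_algebra)
  next
    case (pCons c q)
    have "[:pCons c q:] * v = con c * v + var_h * ([:q:] * v)" for v
    proof -
      have "[:pCons c q:] = con c + var_h * [:q:]" by (simp add: con_def var_h_def)
      then show ?thesis by (simp only: distrib_right mult.assoc)
    qed
    then show ?case
      using stable_op_add[OF stable_op_con stable_op_comp[OF stable_op_h pCons.IH]] by simp
  qed
  have "pCons q p * v = [:q:] * v + var_hb * (p * v)" for v
  proof -
    have "pCons q p = [:q:] + var_hb * p" by (simp add: var_hb_def)
    then show ?thesis by (simp only: distrib_right mult.assoc)
  qed
  then show ?case
    using stable_op_add[OF q stable_op_comp[OF stable_op_hb pCons.IH]] by (simp only:)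
qed

lemma stable_op_mult': "stable_op \<alpha> \<beta> X \<Longrightarrow> stable_op \<alpha> \<beta> (\<lambda>v. p * X v)"
  by (rule stable_op_comp[OF stable_op_mult])

lemma stable_op_minus: "stable_op \<alpha> \<beta> X \<Longrightarrow> stable_op \<alpha> \<beta> (\<lambda>v. - X v)"
  using stable_op_mult'[of X "- 1"] by simp

lemma stable_op_diff: "stable_op \<alpha> \<beta> X \<Longrightarrow> stable_op \<alpha> \<beta> Y \<Longrightarrow> stable_op \<alpha> \<beta> (\<lambda>v. X v - Y v)"
  using stable_op_add[OF _ stable_op_minus, of X Y] by simp

lemmas stable_op_intros = stable_op_mult' stable_op_add stable_op_diff stable_op_minus
  stable_op_shift stable_op_comp[OF stable_op_pderiv stable_op_shift(1)]
  stable_op_comp[OF stable_op_pderiv stable_op_shift(2)]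

lemma is_g_module_eta_span:
  assumes "is_g_module (poly_module E F Eb Fb)"
    and "stable_op \<alpha> \<beta> E" "stable_op \<alpha> \<beta> F" "stable_op \<alpha> \<beta> Eb" "stable_op \<alpha> \<beta> Fb"
  shows "is_g_module (dual_module (poly_module E F Eb Fb)\<lparr>carr := eta_span \<alpha> \<beta>\<rparr>)"
proof (rule is_g_module_sub_dual[OF assms(1)])
  show "eta_span \<alpha> \<beta> \<subseteq> carr (dual_module (poly_module E F Eb Fb))"
    by (auto simp: dual_module_def poly_module_def cscale_conv eta_span_props)
  show "module.subspace (smul (dual_module (poly_module E F Eb Fb))) (eta_span \<alpha> \<beta>)"
    using subspace_eta_span by (simp add: dual_module_def)
  show "act (dual_module (poly_module E F Eb Fb)) x \<phi> \<in> eta_span \<alpha> \<beta>"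
    if "\<phi> \<in> eta_span \<alpha> \<beta>" for x \<phi>
  proof (rule dual_closed[OF subspace_eta_span eta_span_linear _ that])
    fix X \<phi> assume "X \<in> {E, \<lambda>v. var_h * v, F, Eb, \<lambda>v. var_hb * v, Fb}" and \<phi>: "\<phi> \<in> eta_span \<alpha> \<beta>"
    then have "stable_op \<alpha> \<beta> X" using assms(2-) stable_op_h stable_op_hb by auto
    then show "(\<lambda>v. \<phi> (X v)) \<in> eta_span \<alpha> \<beta>" using \<phi> by (simp add: stable_op_def)
  qed
qed

end

lemma is_g_module_M: "l \<noteq> 0 \<Longrightarrow> is_g_module (M_module \<alpha> \<beta> l a b)"
  unfolding M_module_def Gamma_module_def
  by (rule is_g_module_eta_span[OF is_g_module_Gamma[unfolded Gamma_module_def]])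
    (assumption | intro stable_op_intros)+

lemma is_g_module_N: "l \<noteq> 0 \<Longrightarrow> is_g_module (N_module \<alpha> \<beta> l a b)"
  unfolding N_module_def Theta_module_def
  by (rule is_g_module_eta_span[OF is_g_module_Theta[unfolded Theta_module_def]])
    (assumption | intro stable_op_intros)+

lemma is_g_module_V: "l \<noteq> 0 \<Longrightarrow> is_g_module (V_module \<alpha> \<beta> l a \<beta>1)"
  unfolding V_module_def Omega_module_def
  by (rule is_g_module_eta_span[OF is_g_module_Omega[unfolded Omega_module_def]])
    (assumption | intro stable_op_intros)+

end

theory Submission
  imports Defs
begin

text \<open>The three modules share the carrier \<^term>\<open>eta_span \<alpha> \<beta>\<close>, the derivatives in the second variable
  evaluated at the points \<open>(\<alpha> + 2k, \<beta>)\<close>, \<open>k \<in> \<int>\<close>. Such a functional sees a polynomial \<open>\<gamma>\<close> only through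
  the family, indexed by \<open>k\<close>, of the Taylor series at \<open>\<beta>\<close> of \<open>\<gamma>(\<alpha> + 2k, -)\<close>. So the carrier can be
  identified with the finite combinations of coefficient functionals on families of power series
  (\<open>pullback_image\<close>, \<open>inj_on_pullback\<close>). There it makes sense to multiply by any family \<open>g\<close> of power
  series, polynomial or not, and precomposition with \<open>g\<close> is bijective as soon as every \<open>g k\<close> is a unit
  (\<open>bij_betw_twist\<close>).

  The operators of the modules also live on families: \<open>h\<close> is the constant \<open>\<alpha> + 2k\<close>, \<open>h \<otimes> t\<close> is \<open>\<beta> + X\<close>, the
  shift \<open>h \<mapsto> h \<plusminus> 2\<close> moves the index by one, and the derivative is that of power series. Multiplication by
  \<open>g\<close> commutes with \<open>h\<close> and \<open>h \<otimes> t\<close>, so it gives an isomorphism of modules when it also carries the four operators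
  of \<open>e, f, e \<otimes> t, f \<otimes> t\<close> of one module to those of the other (\<open>twist_isomorphism\<close>).

  For \<open>x = \<beta> + X\<close>, the relations for \<open>e \<otimes> t\<close> and \<open>f \<otimes> t\<close> require \<open>g (k + 1) = c r g k\<close>, with
  \<open>r = x\<^sup>2 + a\<close>, \<open>c = -1/(4 l\<^sup>2)\<close> in the first case and \<open>r = x + a\<close>, \<open>c = 1/2\<close> in the second. The
  relations for \<open>e\<close> and \<open>f\<close> require a first order differential equation \<open>r (g k)' = v k g k\<close>. The
  hypothesis that \<open>\<beta>\<close> is not a root of \<open>r\<close> makes \<open>r\<close> a unit, so the equation has a solution that
  is a unit. The recursion and the equation are compatible because \<open>v (k + 1) = v k + r'\<close>
  (\<open>twisting_family_exists\<close>).\<close>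

unbundle no vec_syntax and fps_syntax

section \<open>Linear differential equations for power series\<close>

lemma fps_linear_ode_unique:
  fixes u g g' :: "complex fps"
  assumes g: "fps_deriv g = u * g" and g': "fps_deriv g' = u * g'" and init: "g $ 0 = g' $ 0"
  shows "g = g'"
proof (rule fps_ext)
  fix n
  show "g $ n = g' $ n"
  proof (induction n rule: less_induct)
    case (less n)
    show ?case
    proof (cases n)
      case 0
      then show ?thesis using init by simp
    next
      case (Suc m)
      have "(u * g) $ m = (u * g') $ m"
        unfolding fps_mult_nth by (intro sum.cong) (auto simp: less Suc)
      then have "fps_deriv g $ m = fps_deriv g' $ m" by (simp add: g g')
      then show ?thesis by (simp add: Suc del: of_nat_Suc)
    qed
  qed
qed

text \<open>The solution is \<open>x exp(\<integral>u)\<close>; the integral has no constant term, so the composition makes sense.\<close>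

lemma fps_linear_ode_exists:
  fixes u :: "complex fps"
  shows "\<exists>g. fps_deriv g = u * g \<and> g $ 0 = x"
proof (intro exI conjI)
  let ?g = "fps_const x * (fps_exp 1 oo fps_integral0 u)"
  show "fps_deriv ?g = u * ?g"
    by (simp add: fps_compose_deriv fps_deriv_fps_integral)
  show "?g $ 0 = x" by simp
qed

text \<open>Each \<open>g k\<close> is the solution of its equation with initial value \<open>(c r(0))\<^sup>k\<close>. By Leibniz and the
  relation between \<open>v (k + 1)\<close> and \<open>v k\<close>, \<open>c r g k\<close> solves the equation of \<open>g (k + 1)\<close>, and it has
  the same initial value; so the recursion follows from uniqueness. The last conclusion is the
  equation for \<open>g (k + 1)\<close> with the factor \<open>r\<close> cancelled.\<close>

lemma twisting_family_exists:
  fixes r :: "complex fps" and v :: "int \<Rightarrow> complex fps"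
  assumes r: "r $ 0 \<noteq> 0" and c: "c \<noteq> 0" and v: "\<And>k. v (k + 1) = v k + fps_deriv r"
  obtains g where "\<And>k. g k $ 0 \<noteq> 0" "\<And>k. g (k + 1) = fps_const c * r * g k"
    "\<And>k. r * fps_deriv (g k) = v k * g k"
    "\<And>k. fps_deriv (g (k + 1)) = fps_const c * v (k + 1) * g k"
proof -
  define u where "u k = v k * inverse r" for k
  have ri: "r * inverse r = 1" using r by (rule inverse_mult_eq_1')
  have "\<exists>g. \<forall>k. fps_deriv (g k) = u k * g k \<and> g k $ 0 = (c * r $ 0) powi k"
    by (intro choice allI fps_linear_ode_exists)
  then obtain g where g: "\<And>k. fps_deriv (g k) = u k * g k" and
    g0: "\<And>k. g k $ 0 = (c * r $ 0) powi k"
    by blast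
  have rg: "r * fps_deriv (g k) = v k * g k" for k
    using ri by (simp add: g u_def)
  have D: "fps_deriv (fps_const c * r * g k) = fps_const c * v (k + 1) * g k" for k
  proof -
    have "fps_deriv (fps_const c * r * g k) =
        fps_const c * (r * fps_deriv (g k) + fps_deriv r * g k)"
      by (simp add: algebra_simps)
    then show ?thesis by (simp only: rg v distrib_right mult.assoc)
  qed
  have step: "g (k + 1) = fps_const c * r * g k" for k
  proof (rule fps_linear_ode_unique[OF g])
    have "u (k + 1) * (fps_const c * r * g k) = (r * inverse r) * (fps_const c * v (k + 1) * g k)"
      by (simp only: u_def mult_ac)
    then show "fps_deriv (fps_const c * r * g k) = u (k + 1) * (fps_const c * r * g k)"
      by (simp only: D ri mult_1_left)
    show "g (k + 1) $ 0 = (fps_const c * r * g k) $ 0"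
      using r c by (simp add: g0 power_int_add_1 mult_ac)
  qed
  have "g k $ 0 \<noteq> 0" for k using r c by (simp add: g0)
  moreover have "fps_deriv (g (k + 1)) = fps_const c * v (k + 1) * g k" for k
    unfolding step by (rule D)
  ultimately show ?thesis using step rg that by blast
qed

section \<open>Families of power series and their coefficient functionals\<close>

type_synonym family = "int \<Rightarrow> complex fps"

lemma vector_space_fun_scale: "vector_space (\<lambda>c (\<psi> :: 'a \<Rightarrow> complex) v. c * \<psi> v)"
  by unfold_locales (auto simp: fun_eq_iff algebra_simps)

definition coeff_span :: "(family \<Rightarrow> complex) set" where
  "coeff_span = module.span (\<lambda>c \<psi> f. c * \<psi> f) {\<lambda>f. f k $ n | k n. True}"

interpretation D: vector_space "\<lambda>c (\<psi> :: 'a \<Rightarrow> complex) v. c * \<psi> v"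
  by (rule vector_space_fun_scale)

lemma coeff_span_base: "(\<lambda>f. f k $ n) \<in> coeff_span"
  unfolding coeff_span_def by (rule D.span_base) blast

lemma coeff_span_add: "\<psi> \<in> coeff_span \<Longrightarrow> \<chi> \<in> coeff_span \<Longrightarrow> (\<lambda>f. \<psi> f + \<chi> f) \<in> coeff_span"
  unfolding coeff_span_def using D.span_add by (fastforce simp: plus_fun_def)

lemma coeff_span_scale: "\<psi> \<in> coeff_span \<Longrightarrow> (\<lambda>f. c * \<psi> f) \<in> coeff_span"
  unfolding coeff_span_def by (rule D.span_scale)

lemma coeff_span_zero: "(\<lambda>f. 0) \<in> coeff_span"
  unfolding coeff_span_def using D.span_zero by (simp add: zero_fun_def)

lemma coeff_span_sum:
  "(\<And>i. i \<in> I \<Longrightarrow> \<psi> i \<in> coeff_span) \<Longrightarrow> (\<lambda>f. \<Sum>i\<in>I. \<psi> i f) \<in> coeff_span"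
  by (induction I rule: infinite_finite_induct) (simp_all add: coeff_span_zero coeff_span_add)

lemma coeff_span_induct [consumes 1, case_names zero step]:
  assumes "\<psi> \<in> coeff_span" "P (\<lambda>f. 0)"
    "\<And>c k n \<psi>. \<psi> \<in> coeff_span \<Longrightarrow> P \<psi> \<Longrightarrow> P (\<lambda>f. c * f k $ n + \<psi> f)"
  shows "P \<psi>"
proof -
  have "\<psi> \<in> coeff_span \<and> P \<psi>"
    using assms(1) unfolding coeff_span_def
  proof (induction rule: D.span_induct_alt)
    case base
    then show ?case
      using assms(2) coeff_span_zero by (simp add: zero_fun_def coeff_span_def)
  next
    case (step c x y)
    then obtain k n where x: "x = (\<lambda>f. f k $ n)" by blast
    have y: "y \<in> coeff_span" "P y" using step by (simp_all add: coeff_span_def)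
    have "(\<lambda>f. c * f k $ n + y f) \<in> coeff_span"
      by (intro coeff_span_add coeff_span_scale coeff_span_base y)
    moreover have "P (\<lambda>f. c * f k $ n + y f)" by (rule assms(3)[OF y])
    ultimately show ?case by (simp add: x plus_fun_def coeff_span_def)
  qed
  then show ?thesis ..
qed

lemma coeff_span_plus: "\<psi> \<in> coeff_span \<Longrightarrow> \<psi> (f + f') = \<psi> f + \<psi> f'"
  by (induction rule: coeff_span_induct) (simp_all add: algebra_simps)

text \<open>Only finitely many coefficients of a family matter to a given functional. This is what
  lets polynomials, which cannot realise every family, determine the functional.\<close>

lemma coeff_span_finite:
  "\<psi> \<in> coeff_span \<Longrightarrow>
    \<exists>S. finite S \<and> (\<forall>f f'. (\<forall>(k, n)\<in>S. f k $ n = f' k $ n) \<longrightarrow> \<psi> f = \<psi> f')"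
proof (induction rule: coeff_span_induct)
  case zero
  then show ?case by (intro exI[of _ "{}"]) simp
next
  case (step c k n \<psi>)
  then obtain S where "finite S" "\<forall>f f'. (\<forall>(k, n)\<in>S. f k $ n = f' k $ n) \<longrightarrow> \<psi> f = \<psi> f'"
    by blast
  then show ?case by (intro exI[of _ "insert (k, n) S"]) auto
qed

text \<open>For linear operators this is continuity in the product topology that comes from the discrete topology on
  coefficients: precomposition with the operator again gives finite combinations of coefficients.\<close>

definition preserves_coeff_span :: "(family \<Rightarrow> family) \<Rightarrow> bool" where
  "preserves_coeff_span Y \<longleftrightarrow> (\<forall>\<psi>\<in>coeff_span. (\<lambda>f. \<psi> (Y f)) \<in> coeff_span)"

lemma preserves_coeff_spanI:
  assumes "\<And>k n. (\<lambda>f. Y f k $ n) \<in> coeff_span"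
  shows "preserves_coeff_span Y"
  unfolding preserves_coeff_span_def
proof
  fix \<psi> assume "\<psi> \<in> coeff_span"
  then show "(\<lambda>f. \<psi> (Y f)) \<in> coeff_span"
    by (induction rule: coeff_span_induct)
      (simp_all add: coeff_span_zero coeff_span_add coeff_span_scale assms)
qed

lemma preserves_coeff_span_comp:
  "preserves_coeff_span Y \<Longrightarrow> preserves_coeff_span Z \<Longrightarrow> preserves_coeff_span (\<lambda>f. Z (Y f))"
  unfolding preserves_coeff_span_def by auto

lemma preserves_coeff_span_mult: "preserves_coeff_span (\<lambda>f. g * f)"
  by (rule preserves_coeff_spanI)
    (simp add: fps_mult_nth coeff_span_sum coeff_span_scale coeff_span_base)

section \<open>Expansion of polynomials along the points of the lattice\<close>

context
  fixes \<alpha> \<beta> :: complex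
begin

text \<open>The series at \<open>k\<close> is the Taylor expansion at \<open>\<beta>\<close> of \<open>\<gamma>(\<alpha> + 2k, -)\<close>. Dividing by the factorial
  makes the map multiplicative.\<close>

definition expand :: "cpoly2 \<Rightarrow> family" where
  "expand \<gamma> k = Abs_fps (\<lambda>n. deriv_at (\<alpha> + 2 * of_int k) \<beta> n \<gamma> / fact n)"

lemma deriv_at_conv_expand:
  "deriv_at (\<alpha> + 2 * of_int k) \<beta> n \<gamma> = fact n * expand \<gamma> k $ n"
  by (simp add: expand_def)

lemma expand_add: "expand (p + q) = expand p + expand q"
  by (auto simp: fun_eq_iff fps_eq_iff expand_def deriv_at_add add_divide_distrib)

lemma expand_con_mult: "expand (con c * p) = (\<lambda>k. fps_const c) * expand p"
  by (auto simp: fun_eq_iff fps_eq_iff expand_def deriv_at_con)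

lemma expand_h_mult: "expand (var_h * p) = (\<lambda>k. fps_const (\<alpha> + 2 * of_int k)) * expand p"
  by (auto simp: fun_eq_iff fps_eq_iff expand_def deriv_at_h)

lemma expand_hb_mult: "expand (var_hb * p) = (\<lambda>k. fps_const \<beta> + fps_X) * expand p"
proof -
  have "expand (var_hb * p) k $ n = ((fps_const \<beta> + fps_X) * expand p k) $ n" for k n
    by (cases n)
      (simp_all add: expand_def deriv_at_hb distrib_right add_divide_distrib del: of_nat_Suc)
  then show ?thesis by (auto simp: fun_eq_iff fps_eq_iff)
qed

lemma expand_pderiv: "expand (pderiv p) = (\<lambda>k. fps_deriv (expand p k))"
  by (auto simp: fun_eq_iff fps_eq_iff expand_def deriv_at_pderiv simp del: of_nat_Suc)

lemma expand_shift: "expand (shift 2 p) = (\<lambda>k. expand p (k + 1))"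
  "expand (shift (- 2) p) = (\<lambda>k. expand p (k - 1))"
proof -
  have *: "(\<alpha> + 2 * of_int k) + 2 = \<alpha> + 2 * of_int (k + 1)"
    "(\<alpha> + 2 * of_int k) + - 2 = \<alpha> + 2 * of_int (k - 1)" for k
    by (simp_all add: algebra_simps)
  show "expand (shift 2 p) = (\<lambda>k. expand p (k + 1))"
    "expand (shift (- 2) p) = (\<lambda>k. expand p (k - 1))"
    unfolding expand_def deriv_at_shift * by (rule refl)+
qed

lemma expand_1: "expand 1 = 1"
proof -
  have "deriv_at x \<beta> n 1 = (if n = 0 then 1 else 0)" for x n
    using deriv_at_basis[of x \<beta> n 0 0] by simp
  then show ?thesis by (auto simp: fun_eq_iff fps_eq_iff expand_def)
qed

lemma expand_con: "expand (con c) = (\<lambda>k. fps_const c)"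
  and expand_h: "expand var_h = (\<lambda>k. fps_const (\<alpha> + 2 * of_int k))"
  and expand_hb: "expand var_hb = (\<lambda>k. fps_const \<beta> + fps_X)"
  using expand_con_mult[of c 1] expand_h_mult[of 1] expand_hb_mult[of 1]
  by (simp_all add: expand_1)

lemma expand_mult: "expand (p * q) = expand p * expand q"
proof (induction p)
  case 0
  show ?case using expand_con_mult[of 0 q] expand_con[of 0]
    by (simp add: con_algebra fun_eq_iff)
next
  case (pCons a p)
  have a: "expand ([:a:] * q) = expand [:a:] * expand q" for q
  proof (induction a)
    case 0
    show ?case using expand_con_mult[of 0 q] expand_con[of 0]
      by (simp add: con_algebra fun_eq_iff)
  next
    case (pCons c a)
    have "[:pCons c a:] = con c + var_h * [:a:]" by (simp add: con_def var_h_def)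
    then show ?case
      by (simp only: distrib_right mult.assoc expand_add expand_con_mult expand_con expand_h_mult
          pCons.IH)
  qed
  have "pCons a p = [:a:] + var_hb * p" by (simp add: var_hb_def)
  then show ?case
    by (simp only: distrib_right mult.assoc expand_add expand_hb_mult a pCons.IH)
qed

lemma expand_minus: "expand (- p) = - expand p"
  using expand_con_mult[of "- 1" p] by (simp add: con_algebra fun_eq_iff fps_eq_iff)

lemma expand_diff: "expand (p - q) = expand p - expand q"
  using expand_add[of p "- q"] by (simp add: expand_minus)

lemma expand_power: "expand (p ^ n) = expand p ^ n"
  by (induction n) (simp_all add: expand_1 expand_mult)

lemma expand_0: "expand 0 = 0"
  using expand_diff[of 0 0] by simp

text \<open>The witness is a Lagrange interpolation polynomial in the first variable times \<open>(hb - \<beta>)\<^sup>n\<close>; the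
  points \<open>\<alpha> + 2j\<close> are distinct in characteristic \<open>0\<close>.\<close>

lemma expand_separates:
  assumes "finite S"
  obtains p where "expand p k $ n = 1" "\<And>j m. (j, m) \<in> S \<Longrightarrow> (j, m) \<noteq> (k, n) \<Longrightarrow> expand p j $ m = 0"
proof -
  define J where "J = fst ` S - {k}"
  have J: "finite J" "k \<notin> J" using assms by (simp_all add: J_def)
  define x where "x j = \<alpha> + 2 * of_int j" for j :: int
  define w where "w = (\<Prod>j\<in>J. x k - x j)"
  define q where "q = (\<Prod>j\<in>J. var_h - con (x j))"
  have q: "expand q i = fps_const (\<Prod>j\<in>J. x i - x j)" for i
    unfolding q_def using J(1)
    by (induction J rule: finite_induct)
      (simp_all add: expand_1 expand_mult expand_diff expand_h expand_con x_def)
  have hb: "expand ((var_hb - con \<beta>) ^ n) i = fps_X ^ n" for i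
  proof -
    have "(expand (var_hb - con \<beta>) ^ n) i = (expand (var_hb - con \<beta>) i) ^ n"
      by (induction n) simp_all
    then show ?thesis by (simp add: expand_power expand_diff expand_hb expand_con)
  qed
  have p: "expand (con (1 / w) * q * (var_hb - con \<beta>) ^ n) i =
      fps_const (1 / w * (\<Prod>j\<in>J. x i - x j)) * fps_X ^ n" for i
    by (simp add: expand_mult expand_con q hb)
  have "w \<noteq> 0" using J by (auto simp: w_def x_def)
  show ?thesis
  proof (rule that)
    show "expand (con (1 / w) * q * (var_hb - con \<beta>) ^ n) k $ n = 1"
      unfolding p w_def[symmetric] using \<open>w \<noteq> 0\<close> by simp
    show "expand (con (1 / w) * q * (var_hb - con \<beta>) ^ n) j $ m = 0"
      if "(j, m) \<in> S" "(j, m) \<noteq> (k, n)" for j m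
    proof (cases "j = k")
      case True
      then show ?thesis using that by (simp add: p fps_X_power_nth)
    next
      case False
      then have "j \<in> J" using that(1) by (force simp: J_def)
      then have "(\<Prod>i\<in>J. x j - x i) = 0" using J(1) by auto
      then show ?thesis by (simp add: p)
    qed
  qed
qed

lemma expand_approximates:
  assumes "finite S"
  shows "\<exists>p. \<forall>(k, n)\<in>S. expand p k $ n = f k $ n"
  using assms
proof (induction S rule: finite_induct)
  case (insert s S)
  obtain k n where s: "s = (k, n)" by (cases s)
  obtain p where p: "\<And>j m. (j, m) \<in> S \<Longrightarrow> expand p j $ m = f j $ m" using insert.IH by blast
  obtain q where q: "expand q k $ n = 1"
    "\<And>j m. (j, m) \<in> S \<Longrightarrow> (j, m) \<noteq> (k, n) \<Longrightarrow> expand q j $ m = 0"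
    using expand_separates[OF \<open>finite S\<close>, of k n] by blast
  define r where "r = p + con (f k $ n - expand p k $ n) * q"
  have "expand r j $ m = f j $ m" if "(j, m) \<in> insert s S" for j m
  proof (cases "(j, m) = (k, n)")
    case True
    then show ?thesis by (simp add: r_def expand_add expand_mult expand_con q(1))
  next
    case False
    then have "(j, m) \<in> S" using that s by blast
    from p[OF this] q(2)[OF this False] show ?thesis
      by (simp add: r_def expand_add expand_mult expand_con)
  qed
  then show ?case by blast
qed simp

definition pullback :: "(family \<Rightarrow> complex) \<Rightarrow> cpoly2 \<Rightarrow> complex" where
  "pullback \<psi> = (\<lambda>\<gamma>. \<psi> (expand \<gamma>))"

text \<open>Two functionals involve finitely many coefficients, and on these any family agrees with the
  expansion of some polynomial.\<close>

lemma inj_on_pullback: "inj_on pullback coeff_span"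
proof (rule inj_onI)
  fix \<psi> \<chi> assume \<psi>: "\<psi> \<in> coeff_span" and \<chi>: "\<chi> \<in> coeff_span" and "pullback \<psi> = pullback \<chi>"
  then have eq: "\<psi> (expand \<gamma>) = \<chi> (expand \<gamma>)" for \<gamma> by (simp add: pullback_def fun_eq_iff)
  obtain S T where S: "finite S" "\<And>f f'. (\<forall>(k, n)\<in>S. f k $ n = f' k $ n) \<Longrightarrow> \<psi> f = \<psi> f'"
    and T: "finite T" "\<And>f f'. (\<forall>(k, n)\<in>T. f k $ n = f' k $ n) \<Longrightarrow> \<chi> f = \<chi> f'"
    using coeff_span_finite[OF \<psi>] coeff_span_finite[OF \<chi>] by meson
  show "\<psi> = \<chi>"
  proof
    fix f
    obtain p where "\<forall>(k, n)\<in>S \<union> T. expand p k $ n = f k $ n"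
      using expand_approximates[of "S \<union> T" f] S(1) T(1) by blast
    then have "\<psi> (expand p) = \<psi> f" "\<chi> (expand p) = \<chi> f" by (auto intro!: S(2) T(2))
    then show "\<psi> f = \<chi> f" using eq[of p] by simp
  qed
qed

lemma pullback_image: "pullback ` coeff_span = eta_span \<alpha> \<beta>"
proof
  show "pullback ` coeff_span \<subseteq> eta_span \<alpha> \<beta>"
  proof
    fix \<phi> assume "\<phi> \<in> pullback ` coeff_span"
    then obtain \<psi> where \<phi>: "\<phi> = pullback \<psi>" and "\<psi> \<in> coeff_span" by blast
    from this(2) show "\<phi> \<in> eta_span \<alpha> \<beta>" unfolding \<phi>
    proof (induction rule: coeff_span_induct)
      case zero
      show ?case by (simp add: pullback_def eta_span_zero)
    next
      case (step c k n \<psi>)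
      from eta_span_add[OF eta_span_scale[OF deriv_at_mem[of \<alpha> k \<beta> n], of "c / fact n"] step(2)]
      show ?case by (simp add: pullback_def deriv_at_conv_expand)
    qed
  qed
  show "eta_span \<alpha> \<beta> \<subseteq> pullback ` coeff_span"
  proof
    fix \<phi> assume "\<phi> \<in> eta_span \<alpha> \<beta>"
    then show "\<phi> \<in> pullback ` coeff_span"
      unfolding eta_span_def
    proof (induction rule: D.span_induct_alt)
      case base
      show ?case using coeff_span_zero by (force simp: pullback_def zero_fun_def)
    next
      case (step c x y)
      then obtain k s where x: "x = eta (\<alpha> + 2 * of_int k) \<beta> s" by blast
      obtain \<psi> where \<psi>: "\<psi> \<in> coeff_span" "y = pullback \<psi>" using step by blast
      have "(\<lambda>f. c * (fact (s - 1) * f k $ (s - 1)) + \<psi> f) \<in> coeff_span"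
        by (intro coeff_span_add coeff_span_scale coeff_span_base \<psi>)
      moreover have "(\<lambda>v. c * x v) + y = pullback (\<lambda>f. c * (fact (s - 1) * f k $ (s - 1)) + \<psi> f)"
        by (simp add: fun_eq_iff x \<psi> pullback_def eta_eq deriv_at_conv_expand)
      ultimately show ?case by blast
    qed
  qed
qed

section \<open>Operators that a twist intertwines\<close>

text \<open>The continuity of \<open>Y\<close> makes \<open>\<psi> \<circ> Y\<close> the extension to families of the functional
  \<open>\<phi> \<circ> X\<close> when \<open>\<psi>\<close> is the extension of \<open>\<phi>\<close>.\<close>

definition lifts_to :: "(cpoly2 \<Rightarrow> cpoly2) \<Rightarrow> (family \<Rightarrow> family) \<Rightarrow> bool" where
  "lifts_to X Y \<longleftrightarrow> preserves_coeff_span Y \<and> (\<forall>\<gamma>. expand (X \<gamma>) = Y (expand \<gamma>))"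

lemma lifts_to_mult: "lifts_to X Y \<Longrightarrow> lifts_to (\<lambda>\<gamma>. p * X \<gamma>) (\<lambda>f. expand p * Y f)"
  using preserves_coeff_span_comp[OF _ preserves_coeff_span_mult, of Y "expand p"]
  by (simp add: lifts_to_def expand_mult)

lemma lifts_to_add:
  "lifts_to X Y \<Longrightarrow> lifts_to X' Y' \<Longrightarrow> lifts_to (\<lambda>\<gamma>. X \<gamma> + X' \<gamma>) (\<lambda>f. Y f + Y' f)"
  by (simp add: lifts_to_def preserves_coeff_span_def expand_add coeff_span_plus coeff_span_add)

lemma lifts_to_minus: "lifts_to X Y \<Longrightarrow> lifts_to (\<lambda>\<gamma>. - X \<gamma>) (\<lambda>f. - Y f)"
  using lifts_to_mult[of X Y "- 1"] by (simp add: expand_minus expand_1)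

lemma lifts_to_diff:
  "lifts_to X Y \<Longrightarrow> lifts_to X' Y' \<Longrightarrow> lifts_to (\<lambda>\<gamma>. X \<gamma> - X' \<gamma>) (\<lambda>f. Y f - Y' f)"
  using lifts_to_add[OF _ lifts_to_minus, of X Y X' Y'] by simp

lemma lifts_to_id: "lifts_to (\<lambda>\<gamma>. \<gamma>) (\<lambda>f. f)"
  by (simp add: lifts_to_def preserves_coeff_span_def)

lemma lifts_to_shift: "lifts_to (shift 2) (\<lambda>f k. f (k + 1))" "lifts_to (shift (- 2)) (\<lambda>f k. f (k - 1))"
  by (simp_all add: lifts_to_def expand_shift preserves_coeff_spanI coeff_span_base)

lemma lifts_to_pderiv: "lifts_to X Y \<Longrightarrow> lifts_to (\<lambda>\<gamma>. pderiv (X \<gamma>)) (\<lambda>f k. fps_deriv (Y f k))"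
proof -
  have "preserves_coeff_span (\<lambda>f k. fps_deriv (f k))"
    by (rule preserves_coeff_spanI) (simp add: coeff_span_scale coeff_span_base)
  then show "lifts_to X Y \<Longrightarrow> ?thesis"
    using preserves_coeff_span_comp[of Y "\<lambda>f k. fps_deriv (f k)"]
    by (simp add: lifts_to_def expand_pderiv)
qed

lemmas lifts_to_intros = lifts_to_mult lifts_to_add lifts_to_diff lifts_to_minus lifts_to_pderiv
  lifts_to_shift

text \<open>A lift is determined by its operator, since pulling back is injective on the span of the
  coefficients; so the choice of \<open>Y\<close> and \<open>Y'\<close> does not matter. In the applications they are read off from
  the formulas by \<open>lifts_to_intros\<close>.\<close>

definition twist_equivalent :: "family \<Rightarrow> (cpoly2 \<Rightarrow> cpoly2) \<Rightarrow> (cpoly2 \<Rightarrow> cpoly2) \<Rightarrow> bool" where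
  "twist_equivalent g X X' \<longleftrightarrow>
     (\<exists>Y Y'. lifts_to X Y \<and> lifts_to X' Y' \<and> (\<forall>f. Y (g * f) = g * Y' f))"

lemma twist_equivalentI:
  "lifts_to X Y \<Longrightarrow> lifts_to X' Y' \<Longrightarrow> (\<And>f k. Y (g * f) k = g k * Y' f k) \<Longrightarrow> twist_equivalent g X X'"
  unfolding twist_equivalent_def by (force simp: fun_eq_iff)

lemma twist_equivalent_id: "twist_equivalent g (\<lambda>\<gamma>. \<gamma>) (\<lambda>\<gamma>. \<gamma>)"
  by (rule twist_equivalentI[OF lifts_to_id lifts_to_id]) simp

lemma twist_equivalent_mult:
  assumes "twist_equivalent g X X'"
  shows "twist_equivalent g (\<lambda>\<gamma>. p * X \<gamma>) (\<lambda>\<gamma>. p * X' \<gamma>)"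
proof -
  obtain Y Y' where Y: "lifts_to X Y" "lifts_to X' Y'" "\<And>f. Y (g * f) = g * Y' f"
    using assms unfolding twist_equivalent_def by blast
  show ?thesis
    by (rule twist_equivalentI[OF lifts_to_mult[OF Y(1)] lifts_to_mult[OF Y(2)]])
      (simp add: Y(3) mult.left_commute)
qed

lemma twist_equivalent_add:
  assumes "twist_equivalent g X X'" "twist_equivalent g Z Z'"
  shows "twist_equivalent g (\<lambda>\<gamma>. X \<gamma> + Z \<gamma>) (\<lambda>\<gamma>. X' \<gamma> + Z' \<gamma>)"
proof -
  obtain Y Y' where Y: "lifts_to X Y" "lifts_to X' Y'" "\<And>f. Y (g * f) = g * Y' f"
    using assms(1) unfolding twist_equivalent_def by blast
  obtain U U' where U: "lifts_to Z U" "lifts_to Z' U'" "\<And>f. U (g * f) = g * U' f"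
    using assms(2) unfolding twist_equivalent_def by blast
  show ?thesis
    by (rule twist_equivalentI[OF lifts_to_add[OF Y(1) U(1)] lifts_to_add[OF Y(2) U(2)]])
      (simp add: Y(3) U(3) distrib_left)
qed

text \<open>Multiplication by \<open>g\<close> does not preserve polynomials, so the functional is first extended to
  families, in the only possible way within the span of the coefficients.\<close>

definition twist :: "family \<Rightarrow> (cpoly2 \<Rightarrow> complex) \<Rightarrow> cpoly2 \<Rightarrow> complex" where
  "twist g \<phi> = pullback (\<lambda>f. inv_into coeff_span pullback \<phi> (g * f))"

lemma twist_pullback: "\<psi> \<in> coeff_span \<Longrightarrow> twist g (pullback \<psi>) = pullback (\<lambda>f. \<psi> (g * f))"
  by (simp add: twist_def inv_into_f_f[OF inj_on_pullback])

lemma twist_mem: "\<phi> \<in> eta_span \<alpha> \<beta> \<Longrightarrow> twist g \<phi> \<in> eta_span \<alpha> \<beta>"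
  using preserves_coeff_span_mult[of g]
  by (auto simp: pullback_image[symmetric] twist_pullback preserves_coeff_span_def)

lemma twist_twist: "\<phi> \<in> eta_span \<alpha> \<beta> \<Longrightarrow> twist g (twist g' \<phi>) = twist (g' * g) \<phi>"
  using preserves_coeff_span_mult
  by (auto simp: pullback_image[symmetric] twist_pullback preserves_coeff_span_def mult.assoc)

lemma twist_one: "\<phi> \<in> eta_span \<alpha> \<beta> \<Longrightarrow> twist 1 \<phi> = \<phi>"
  by (auto simp: pullback_image[symmetric] twist_pullback)

text \<open>The inverse is the twist by the family of inverses.\<close>

lemma bij_betw_twist:
  assumes "\<And>k. g k $ 0 \<noteq> 0"
  shows "bij_betw (twist g) (eta_span \<alpha> \<beta>) (eta_span \<alpha> \<beta>)"
proof -
  have g: "g * (\<lambda>k. inverse (g k)) = 1"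
    using assms by (simp add: fun_eq_iff inverse_mult_eq_1')
  show ?thesis
    by (rule bij_betwI[where g = "twist (\<lambda>k. inverse (g k))"])
      (simp_all add: twist_mem twist_twist g mult.commute[of _ g] twist_one)
qed

lemma twist_add:
  assumes "\<phi> \<in> eta_span \<alpha> \<beta>" "\<phi>' \<in> eta_span \<alpha> \<beta>"
  shows "twist g (\<phi> + \<phi>') = twist g \<phi> + twist g \<phi>'"
proof -
  obtain \<psi> \<psi>' where \<psi>: "\<psi> \<in> coeff_span" "\<phi> = pullback \<psi>" "\<psi>' \<in> coeff_span" "\<phi>' = pullback \<psi>'"
    using assms by (auto simp: pullback_image[symmetric])
  have "\<phi> + \<phi>' = pullback (\<lambda>f. \<psi> f + \<psi>' f)" by (simp add: \<psi> pullback_def fun_eq_iff)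
  then show ?thesis
    using twist_pullback[OF coeff_span_add[OF \<psi>(1,3)]]
    by (simp add: \<psi> twist_pullback) (simp add: pullback_def fun_eq_iff)
qed

lemma twist_scale:
  assumes "\<phi> \<in> eta_span \<alpha> \<beta>"
  shows "twist g (\<lambda>\<gamma>. c * \<phi> \<gamma>) = (\<lambda>\<gamma>. c * twist g \<phi> \<gamma>)"
proof -
  obtain \<psi> where \<psi>: "\<psi> \<in> coeff_span" "\<phi> = pullback \<psi>"
    using assms by (auto simp: pullback_image[symmetric])
  have "(\<lambda>\<gamma>. c * \<phi> \<gamma>) = pullback (\<lambda>f. c * \<psi> f)" by (simp add: \<psi> pullback_def)
  then show ?thesis
    using twist_pullback[OF coeff_span_scale[OF \<psi>(1)]]
    by (simp add: \<psi> twist_pullback) (simp add: pullback_def)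
qed

text \<open>If \<open>\<phi>\<close> extends to \<open>\<psi>\<close>, then \<open>\<phi> \<circ> X\<close> extends to \<open>\<psi> \<circ> Y\<close>, and \<open>\<psi>(Y(g f)) = \<psi>(g (Y' f))\<close>.\<close>

lemma twist_intertwines:
  assumes "twist_equivalent g X X'" "\<phi> \<in> eta_span \<alpha> \<beta>"
  shows "twist g (\<lambda>\<gamma>. \<phi> (X \<gamma>)) = (\<lambda>\<gamma>. twist g \<phi> (X' \<gamma>))"
proof -
  obtain \<psi> where \<psi>: "\<psi> \<in> coeff_span" "\<phi> = pullback \<psi>"
    using assms(2) by (auto simp: pullback_image[symmetric])
  obtain Y Y' where Y: "lifts_to X Y" "lifts_to X' Y'" "\<forall>f. Y (g * f) = g * Y' f"
    using assms(1) unfolding twist_equivalent_def by blast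
  have "(\<lambda>\<gamma>. \<phi> (X \<gamma>)) = pullback (\<lambda>f. \<psi> (Y f))"
    using Y(1) by (simp add: \<psi> pullback_def lifts_to_def)
  moreover have "(\<lambda>f. \<psi> (Y f)) \<in> coeff_span"
    using Y(1) \<psi>(1) by (simp add: lifts_to_def preserves_coeff_span_def)
  ultimately show ?thesis
    using Y(2,3) by (simp add: \<psi> twist_pullback) (simp add: pullback_def lifts_to_def)
qed

text \<open>The action of an arbitrary element of the algebra is a linear combination of the six operators, and
  twist equivalence is stable under linear combinations. The sign in the definition of
  the dual action is harmless since the twist is linear.\<close>

theorem twist_isomorphism:
  assumes "is_g_module (dual_module (poly_module E F Eb Fb)\<lparr>carr := eta_span \<alpha> \<beta>\<rparr>)"
    and "is_g_module (dual_module (poly_module E' F' Eb' Fb')\<lparr>carr := eta_span \<alpha> \<beta>\<rparr>)"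
    and unit: "\<And>k. g k $ 0 \<noteq> 0"
    and eqv: "twist_equivalent g E E'" "twist_equivalent g F F'"
      "twist_equivalent g Eb Eb'" "twist_equivalent g Fb Fb'"
  shows "dual_module (poly_module E F Eb Fb)\<lparr>carr := eta_span \<alpha> \<beta>\<rparr> \<cong>\<^sub>g
         dual_module (poly_module E' F' Eb' Fb')\<lparr>carr := eta_span \<alpha> \<beta>\<rparr>"
proof -
  let ?A = "\<lambda>x. act (poly_module E F Eb Fb) x" and ?A' = "\<lambda>x. act (poly_module E' F' Eb' Fb') x"
  have "twist_equivalent g (?A x) (?A' x)" for x
    unfolding poly_module_def takiff_action_def g_module.simps cscale_conv
    by (intro twist_equivalent_add twist_equivalent_mult twist_equivalent_id eqv)
  then have int: "twist g (\<lambda>\<gamma>. - \<phi> (?A x \<gamma>)) = (\<lambda>\<gamma>. - twist g \<phi> (?A' x \<gamma>))"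
    if "\<phi> \<in> eta_span \<alpha> \<beta>" for x \<phi>
    using twist_intertwines[OF _ eta_span_scale[OF that, of "- 1"]] twist_scale[OF that, of _ "- 1"]
    by (simp add: fun_eq_iff)
  show ?thesis
    unfolding g_isomorphic_def
    using assms(1,2) bij_betw_twist[OF unit] twist_add twist_scale int
    by (intro conjI exI[of _ "twist g"]) (simp_all add: dual_module_def poly_module_def)
qed

end

section \<open>The two isomorphisms\<close>

text \<open>Replacing the constants by letters \<open>L\<close>, \<open>W\<close>, \<open>H\<close> that stand for \<open>l\<close>, \<open>1/l\<close>, \<open>1/2\<close> turns the operator
  identities below into polynomial identities modulo \<open>L W = 1\<close> and \<open>2 H = 1\<close>, which Groebner bases
  decide.\<close>

lemma fps_const_fractions:
  assumes "l \<noteq> (0 :: complex)"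
  obtains L W H :: "complex fps" where "L * W = 1" "2 * H = 1"
    "fps_const l = L" "fps_const (1 / l) = W" "fps_const (l / 2) = H * L" "fps_const (1 / 2) = H"
    "fps_const (2 * l) = 2 * L" "fps_const (- (2 * l)) = - 2 * L"
    "fps_const (1 / (2 * l)) = H * W" "fps_const (- (1 / (2 * l))) = - (H * W)"
    "fps_const (- (1 / (4 * l))) = - (H * H * W)"
    "fps_const (- (1 / (4 * l^2))) = - (H * H * W * W)"
proof (rule that[of "fps_const l" "fps_const (1 / l)" "fps_const (1 / 2)"])
qed (use assms in \<open>simp_all add: fps_numeral_fps_const power2_eq_square\<close>)

lemmas expand_simps = expand_mult expand_add expand_diff expand_minus expand_con expand_h expand_hb

lemma expand_in_hb: "expand \<alpha> \<beta> (in_hb p) j = expand \<alpha> \<beta> (in_hb p) k"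
proof (induction p)
  case (pCons c p)
  have "pCons c p = [:c:] + [:0, 1:] * p" by simp
  then have "in_hb (pCons c p) = con c + (var_hb + con 0) * in_hb p"
    by (simp only: in_hb_algebra)
  then show ?case using pCons.IH by (simp add: expand_simps)
qed (simp add: in_hb_def expand_0)

text \<open>The twist is formally \<open>(-r/(4 l\<^sup>2))\<^sup>k exp(\<integral>(\<alpha> x + b)/r)\<close> with \<open>r = x\<^sup>2 + a\<close>. The factor \<open>r\<close> in the
  operators of \<open>e \<otimes> t\<close> and \<open>f \<otimes> t\<close> changes sides, and the terms of \<open>e\<close> and \<open>f\<close> without derivative
  are produced or absorbed by the logarithmic derivative of \<open>g\<close>.\<close>

lemma N_module_iso_M_module:
  assumes l: "l \<noteq> 0" and nz: "\<beta>^2 + a \<noteq> 0"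
  shows "N_module \<alpha> \<beta> l a b \<cong>\<^sub>g M_module \<alpha> \<beta> l a b"
proof -
  obtain L W H where LWH: "L * W = 1" "2 * H = 1" and
    con: "fps_const l = L" "fps_const (2 * l) = 2 * L" "fps_const (- (2 * l)) = - 2 * L"
    "fps_const (1 / (2 * l)) = H * W" "fps_const (- (1 / (2 * l))) = - (H * W)"
    "fps_const (- (1 / (4 * l))) = - (H * H * W)"
    "fps_const (- (1 / (4 * l^2))) = - (H * H * W * W)"
    by (rule fps_const_fractions[OF l])
  obtain x where x: "fps_const \<beta> + fps_X = x" by simp
  obtain A B where AB: "fps_const a = A" "fps_const b = B" by simp
  obtain s where s: "\<And>k. fps_const (\<alpha> + 2 * of_int k) = s k" by simp
  have s_step: "s (k + 1) = s k + 2" for k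
    by (simp add: s[symmetric] fps_numeral_fps_const algebra_simps)
  have two: "fps_const 2 = (2 :: complex fps)" by (simp add: fps_numeral_fps_const)
  define r where "r = x * x + A"
  define v where "v k = s k * x + B" for k
  have "fps_deriv r = 2 * x" by (simp add: r_def x[symmetric] AB[symmetric])
  then have "v (k + 1) = v k + fps_deriv r" for k
    by (simp add: v_def s_step distrib_right)
  moreover have "r $ 0 \<noteq> 0"
    using nz by (simp add: r_def x[symmetric] AB[symmetric] power2_eq_square)
  ultimately obtain g where unit: "\<And>k. g k $ 0 \<noteq> 0"
    and "\<And>k. g (k + 1) = fps_const (- (1 / (4 * l^2))) * r * g k"
    and "\<And>k. r * fps_deriv (g k) = v k * g k"
    and "\<And>k. fps_deriv (g (k + 1)) = fps_const (- (1 / (4 * l^2))) * v (k + 1) * g k"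
    using l twisting_family_exists[of r "- (1 / (4 * l^2))" v] by auto
  then have step: "g (k + 1) = - (H * H * W * W) * (x * x + A) * g k"
    and ode: "(x * x + A) * fps_deriv (g k) = (s k * x + B) * g k"
    and dstep: "fps_deriv (g (k + 1)) = - (H * H * W * W) * ((s k + 2) * x + B) * g k" for k
    by (simp_all only: con r_def v_def s_step)
  show ?thesis
    unfolding N_module_def M_module_def Theta_module_def Gamma_module_def
  proof (rule twist_isomorphism[OF _ _ unit])
    show "twist_equivalent \<alpha> \<beta> g
      (\<lambda>\<gamma>. con (- (1 / (2 * l))) * ((var_h - con 2) * var_hb + con b) * shift (- 2) \<gamma>
          + con (1 / (2 * l)) * (var_hb^2 + con a) * pderiv (shift (- 2) \<gamma>))
      (\<lambda>\<gamma>. con (- 2 * l) * pderiv (shift (- 2) \<gamma>))"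
      apply (rule twist_equivalentI)
      apply (rule lifts_to_intros)+
      subgoal for f k
        using LWH step[of "k - 1", simplified] ode[of "k - 1"] s_step[of "k - 1", simplified]
        by (simp add: power2_eq_square expand_simps two con x AB s) algebra
      done
    show "twist_equivalent \<alpha> \<beta> g
      (\<lambda>\<gamma>. con (2 * l) * pderiv (shift 2 \<gamma>))
      (\<lambda>\<gamma>. con (- (1 / (2 * l))) * ((var_h + con 2) * var_hb + con b) * shift 2 \<gamma>
          - con (1 / (2 * l)) * (var_hb^2 + con a) * pderiv (shift 2 \<gamma>))"
      apply (rule twist_equivalentI)
      apply (rule lifts_to_intros)+
      subgoal for f k
        using LWH step[of k] dstep[of k] s_step[of k]
        by (simp add: power2_eq_square expand_simps two con x AB s) algebra
      done
    show "twist_equivalent \<alpha> \<beta> g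
      (\<lambda>\<gamma>. con (- (1 / (4 * l))) * (var_hb^2 + con a) * shift (- 2) \<gamma>)
      (\<lambda>\<gamma>. con l * shift (- 2) \<gamma>)"
      apply (rule twist_equivalentI)
      apply (rule lifts_to_intros)+
      subgoal for f k
        using LWH step[of "k - 1", simplified] ode[of "k - 1"] s_step[of "k - 1", simplified]
        by (simp add: power2_eq_square expand_simps two con x AB s) algebra
      done
    show "twist_equivalent \<alpha> \<beta> g (\<lambda>\<gamma>. con l * shift 2 \<gamma>)
      (\<lambda>\<gamma>. con (- (1 / (4 * l))) * (var_hb^2 + con a) * shift 2 \<gamma>)"
      apply (rule twist_equivalentI)
      apply (rule lifts_to_intros)+
      subgoal for f k
        using LWH step[of k] dstep[of k] s_step[of k]
        by (simp add: power2_eq_square expand_simps two con x AB s)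
      done
  qed (use is_g_module_N[OF l, of \<alpha> \<beta> a b] is_g_module_M[OF l, of \<alpha> \<beta> a b] in
    \<open>simp_all only: N_module_def M_module_def Theta_module_def Gamma_module_def\<close>)
qed

text \<open>Here \<open>r = x + a\<close>. The operator of \<open>e\<close> forces the logarithmic derivative of \<open>g k\<close> to be
  \<open>((\<alpha> + 2k)/2 + 1 + \<alpha>1/l)/r\<close>. The operator of \<open>f\<close> then has to match as well; this is the identity
  \<open>(x - a) \<alpha>1 = l\<^sup>2 ((x + a) \<beta>1 - 2 a \<beta>1(a))\<close>, and the remainder \<open>2 a \<beta>1(a)\<close> is the
  source of the term in \<open>\<beta>1(a)\<close> among the parameters of the target.\<close>

lemma V_module_iso_M_module:
  assumes l: "l \<noteq> 0" and nz: "\<beta> + a \<noteq> 0"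
  shows "V_module \<alpha> \<beta> l a \<beta>1 \<cong>\<^sub>g
    M_module \<alpha> \<beta> l (- (a^2)) (- 2 * a * (l * poly \<beta>1 a + 1))"
proof -
  obtain L W H where LWH: "L * W = 1" "2 * H = 1" and
    con: "fps_const l = L" "fps_const (1 / l) = W" "fps_const (l / 2) = H * L" "fps_const (1 / 2) = H"
    "fps_const (- (2 * l)) = - 2 * L"
    "fps_const (1 / (2 * l)) = H * W" "fps_const (- (1 / (2 * l))) = - (H * W)"
    "fps_const (- (1 / (4 * l))) = - (H * H * W)"
    by (rule fps_const_fractions[OF l])
  obtain x where x: "fps_const \<beta> + fps_X = x" by simp
  obtain s where s: "\<And>k. fps_const (\<alpha> + 2 * of_int k) = s k" by simp
  have s_step: "s (k + 1) = s k + 2" for k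
    by (simp add: s[symmetric] fps_numeral_fps_const algebra_simps)
  have two: "fps_const 2 = (2 :: complex fps)" by (simp add: fps_numeral_fps_const)
  obtain A P where A: "fps_const a = A" "fps_const (poly \<beta>1 a) = P" by simp
  have nA: "fps_const (- a) = - A" by (simp add: A[symmetric])
  have AA: "fps_const (- (a^2)) = - (A * A)"
    and B: "fps_const (- (2 * a * (l * poly \<beta>1 a + 1))) = - 2 * A * (L * P + 1)"
    by (simp_all add: A[symmetric] con(1)[symmetric] power2_eq_square fps_numeral_fps_const
        flip: fps_const_1_eq_1)
  obtain p q where pq: "\<And>k. expand \<alpha> \<beta> (in_hb (alpha1 l a \<beta>1)) k = p"
    "\<And>k. expand \<alpha> \<beta> (in_hb \<beta>1) k = q"
    using expand_in_hb[of \<alpha> \<beta>] by metis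
  have "expand \<alpha> \<beta> (in_hb ([:- a, 1:] * alpha1 l a \<beta>1)) 0 =
      expand \<alpha> \<beta> (in_hb (smult (l^2) ([:a, 1:] * \<beta>1 - [:2 * a * poly \<beta>1 a:]))) 0"
    by (simp only: alpha1_eq)
  then have alpha1: "(x - A) * p = L * L * ((x + A) * q - 2 * A * P)"
    unfolding in_hb_algebra
    by (simp add: power2_eq_square expand_simps con_algebra(4) two con x A nA pq)
  define r where "r = x + A"
  define v where "v k = H * s k + 1 + W * p" for k
  have "fps_deriv r = 1" by (simp add: r_def x[symmetric] A[symmetric])
  moreover have "H * s (k + 1) = H * s k + 1" for k
    using LWH(2) by (simp add: s_step distrib_left mult.commute[of H 2])
  ultimately have "v (k + 1) = v k + fps_deriv r" for k
    by (simp add: v_def)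
  moreover have "r $ 0 \<noteq> 0"
    using nz by (simp add: r_def x[symmetric] A[symmetric])
  ultimately obtain g where unit: "\<And>k. g k $ 0 \<noteq> 0"
    and "\<And>k. g (k + 1) = fps_const (1 / 2) * r * g k"
    and "\<And>k. r * fps_deriv (g k) = v k * g k"
    and "\<And>k. fps_deriv (g (k + 1)) = fps_const (1 / 2) * v (k + 1) * g k"
    using twisting_family_exists[of r "1 / 2" v] by auto
  then have step: "g (k + 1) = H * (x + A) * g k"
    and ode: "(x + A) * fps_deriv (g k) = (H * s k + 1 + W * p) * g k"
    and dstep: "fps_deriv (g (k + 1)) = H * (H * (s k + 2) + 1 + W * p) * g k" for k
    by (simp_all only: con r_def v_def s_step)
  \<comment> \<open>In the next two relations \<open>p\<close> has the coefficients that it has in the operator identities, which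
    keeps the Groebner basis computations short.\<close>
  have alpha1': "W * W * ((x - A) * p) = (x + A) * q - 2 * A * P"
  proof -
    have "W * W * ((x - A) * p) = (L * W) * (L * W) * ((x + A) * q - 2 * A * P)"
      unfolding alpha1 by (simp only: mult_ac)
    then show ?thesis by (simp only: LWH mult_1_left)
  qed
  have ode': "L * ((x + A) * fps_deriv (g k)) = (H * L * s k + L + p) * g k" for k
  proof -
    have "L * ((x + A) * fps_deriv (g k)) = (H * L * s k + L + (L * W) * p) * g k"
      unfolding ode by (simp add: algebra_simps)
    then show ?thesis by (simp only: LWH mult_1_left)
  qed
  show ?thesis
    unfolding V_module_def M_module_def Omega_module_def Gamma_module_def
  proof (rule twist_isomorphism[OF _ _ unit])
    show "twist_equivalent \<alpha> \<beta> g
      (\<lambda>\<gamma>. (con (l / 2) * var_h + in_hb (alpha1 l a \<beta>1)) * shift (- 2) \<gamma>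
          - con l * (var_hb + con a) * pderiv (shift (- 2) \<gamma>))
      (\<lambda>\<gamma>. con (- 2 * l) * pderiv (shift (- 2) \<gamma>))"
      apply (rule twist_equivalentI)
      apply (rule lifts_to_intros)+
      subgoal for f k
        using LWH(2) step[of "k - 1", simplified] ode'[of "k - 1"] s_step[of "k - 1", simplified]
        by (simp add: power2_eq_square expand_simps two con x pq A s) algebra
      done
    show "twist_equivalent \<alpha> \<beta> g
      (\<lambda>\<gamma>. - ((con (1 / (2 * l)) * var_h - in_hb \<beta>1) * shift 2 \<gamma>)
          - con (1 / l) * (var_hb - con a) * pderiv (shift 2 \<gamma>))
      (\<lambda>\<gamma>. con (- (1 / (2 * l))) *
            ((var_h + con 2) * var_hb + con (- 2 * a * (l * poly \<beta>1 a + 1))) * shift 2 \<gamma>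
          - con (1 / (2 * l)) * (var_hb^2 + con (- (a^2))) * pderiv (shift 2 \<gamma>))"
      apply (rule twist_equivalentI)
      apply (rule lifts_to_intros)+
      subgoal for f k
        using LWH alpha1'
        apply (simp add: power2_eq_square[of var_hb] expand_simps two con x pq A AA B s)
        \<comment> \<open>The derivative has to be replaced while its argument still has the form \<open>g (k + 1)\<close>.\<close>
        apply (unfold dstep, unfold step)
        apply algebra
        done
      done
    show "twist_equivalent \<alpha> \<beta> g
      (\<lambda>\<gamma>. con (l / 2) * (var_hb + con a) * shift (- 2) \<gamma>)
      (\<lambda>\<gamma>. con l * shift (- 2) \<gamma>)"
      apply (rule twist_equivalentI)
      apply (rule lifts_to_intros)+
      subgoal for f k
        using LWH(2) step[of "k - 1", simplified] ode'[of "k - 1"] s_step[of "k - 1", simplified]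
        by (simp add: power2_eq_square expand_simps two con x A s)
      done
    show "twist_equivalent \<alpha> \<beta> g
      (\<lambda>\<gamma>. con (- (1 / (2 * l))) * (var_hb - con a) * shift 2 \<gamma>)
      (\<lambda>\<gamma>. con (- (1 / (4 * l))) * (var_hb^2 + con (- (a^2))) * shift 2 \<gamma>)"
      apply (rule twist_equivalentI)
      apply (rule lifts_to_intros)+
      subgoal for f k
        using LWH
        by (simp add: power2_eq_square[of var_hb] expand_simps two con x A AA s step)
          (simp add: algebra_simps)
      done
  qed (use is_g_module_V[OF l, of \<alpha> \<beta> a \<beta>1] is_g_module_M[OF l, of \<alpha> \<beta> "- (a^2)"
        "- 2 * a * (l * poly \<beta>1 a + 1)"] in
    \<open>simp_all only: V_module_def M_module_def Omega_module_def Gamma_module_def\<close>)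
qed

theorem theorem1p5:
  fixes l \<alpha> \<beta> a b :: complex and \<beta>1 :: "complex poly"
  assumes "l \<noteq> 0"
  shows "(\<beta>^2 + a \<noteq> 0 \<longrightarrow> N_module \<alpha> \<beta> l a b \<cong>\<^sub>g M_module \<alpha> \<beta> l a b) \<and>
         (\<beta> + a \<noteq> 0 \<longrightarrow>
            V_module \<alpha> \<beta> l a \<beta>1 \<cong>\<^sub>g M_module \<alpha> \<beta> l (- (a^2)) (- 2 * a * (l * poly \<beta>1 a + 1)))"
  using N_module_iso_M_module[OF assms] V_module_iso_M_module[OF assms] by blast

end
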